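(* There exists a set $P\subset\mathbb{N}$ such that the spacing shift $(\Omega_P,\sigma_P)$ is weakly mixing, proximal, and has positive topological entropy. Hence, there is a DC$2$-chaotic spacing shift which is not DC$1$-chaotic.
   Context: $\mathbb{N}=\{1,2,\ldots\}$. For $P\subset\mathbb{N}$ the spacing shift $\Omega_P$ is the set of all $\omega\in\{0,1\}^{\mathbb{N}}$ such that $\omega_i=\omega_j=1$ and $i\ne j$ imply $|i-j|\in P$; it is a closed subset of $\{0,1\}^{\mathbb{N}}$ (product topology) and $\sigma_P$ is the restriction to it of the shift $\sigma$, $(\sigma(\omega))_i=\omega_{i+1}$. The metric is $\rho(\omega,\gamma)=2^{-\min\{k\in\mathbb{N}:\omega_k\ne\gamma_k\}}$ for $\omega\neq\gamma$ and $\rho(\omega,\omega)=0$. A system $(X,f)$ is weakly mixing if for all nonempty open $U,V\subset X$ the set $N(U,V)=\{k>0:f^k(U)\cap V\neq\emptyset\}$ is thick, i.e. contains arbitrarily long blocks of consecutive integers. It is proximal if $\liminf_{k\to\infty}\rho(f^k(x),f^k(y))=0$ for all $x,y\in X$. The topological entropy is $h(\Omega_P)=\lim_{k\to\infty}\frac1k\log\#\mathcal{L}_k(\Omega_P)$, where $\mathcal{L}_k(\Omega_P)$ is the set of words of length $k$ appearing in elements of $\Omega_P$ (logarithm base 2). For points $x,y$ and $t\in\mathbb{R}$ put $F_{xy}(t)=\liminf_{m\to\infty}\frac1m\#\{0\le j\le m-1:\rho(f^j(x),f^j(y))<t\}$ and $F^*_{xy}(t)=\limsup_{m\to\infty}\frac1m\#\{0\le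 j\le m-1:\rho(f^j(x),f^j(y))<t\}$. A pair $(x,y)$ is DC$1$-scrambled if $F^*_{xy}(t)=1$ for all $t>0$ and $F_{xy}(s)=0$ for some $s>0$; it is DC$2$-scrambled if $F^*_{xy}(t)=1$ for all $t>0$ and $F_{xy}(s)<1$ for some $s>0$. The system is DC$i$-chaotic if there is an uncountable set $S$ of points such that every pair of distinct points of $S$ is DC$i$-scrambled. *)

theory Defs
  imports "HOL-Analysis.Analysis"
begin

text \<open>
  Points of the full shift are functions \<open>nat \<Rightarrow> bool\<close> with the product topology, where
  \<^const>\<open>True\<close> plays the role of the symbol \<open>1\<close>. The sequences are indexed by the positive
  integers in the source, so \<open>x i\<close> here is the symbol at position \<open>i + 1\<close>.
\<close>

definition shift_map :: "(nat \<Rightarrow> bool) \<Rightarrow> (nat \<Rightarrow> bool)" where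
  "shift_map x = (\<lambda>i. x (Suc i))"

definition spacing_shift :: "nat set \<Rightarrow> (nat \<Rightarrow> bool) set" where
  "spacing_shift P = {x. \<forall>i j. x i \<and> x j \<and> i \<noteq> j \<longrightarrow> nat \<bar>int i - int j\<bar> \<in> P}"

text \<open>The \<^const>\<open>Suc\<close> converts the least index of disagreement to a position in the positive integers.\<close>

definition rho :: "(nat \<Rightarrow> bool) \<Rightarrow> (nat \<Rightarrow> bool) \<Rightarrow> real" where
  "rho x y = (if x = y then 0 else (1/2) ^ Suc (LEAST k. x k \<noteq> y k))"

definition thick :: "nat set \<Rightarrow> bool" where
  "thick A \<longleftrightarrow> (\<forall>n. \<exists>a. {a..<a + n} \<subseteq> A)"

definition hitting_times :: "('a \<Rightarrow> 'a) \<Rightarrow> 'a set \<Rightarrow> 'a set \<Rightarrow> nat set" where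
  "hitting_times f U V = {k. k > 0 \<and> (f ^^ k) ` U \<inter> V \<noteq> {}}"

definition weakly_mixing :: "'a::topological_space set \<Rightarrow> ('a \<Rightarrow> 'a) \<Rightarrow> bool" where
  "weakly_mixing X f \<longleftrightarrow>
    (\<forall>U V. openin (top_of_set X) U \<and> openin (top_of_set X) V \<and> U \<noteq> {} \<and> V \<noteq> {}
       \<longrightarrow> thick (hitting_times f U V))"

text \<open>
  The remaining notions take the metric \<open>d\<close> as a parameter. Lower and upper limits are taken in
  \<^typ>\<open>ereal\<close>, where they always exist.
\<close>

definition proximal :: "('a \<Rightarrow> 'a \<Rightarrow> real) \<Rightarrow> 'a set \<Rightarrow> ('a \<Rightarrow> 'a) \<Rightarrow> bool" where
  "proximal d X f \<longleftrightarrow>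
    (\<forall>x\<in>X. \<forall>y\<in>X. liminf (\<lambda>k. ereal (d ((f ^^ k) x) ((f ^^ k) y))) = 0)"

definition words :: "nat \<Rightarrow> (nat \<Rightarrow> bool) set \<Rightarrow> bool list set" where
  "words k X = {map x [i..<i + k] | x i. x \<in> X}"

text \<open>
  The limit exists for every nonempty shift-invariant \<open>X\<close>, because the number of words is then
  submultiplicative in their length.
\<close>

definition entropy :: "(nat \<Rightarrow> bool) set \<Rightarrow> real" where
  "entropy X = lim (\<lambda>k. log 2 (real (card (words k X))) / real k)"

definition close_freq ::
    "('a \<Rightarrow> 'a \<Rightarrow> real) \<Rightarrow> ('a \<Rightarrow> 'a) \<Rightarrow> 'a \<Rightarrow> 'a \<Rightarrow> real \<Rightarrow> nat \<Rightarrow> real" where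
  "close_freq d f x y t m = real (card {j. j < m \<and> d ((f ^^ j) x) ((f ^^ j) y) < t}) / real m"

definition lower_distr ::
    "('a \<Rightarrow> 'a \<Rightarrow> real) \<Rightarrow> ('a \<Rightarrow> 'a) \<Rightarrow> 'a \<Rightarrow> 'a \<Rightarrow> real \<Rightarrow> ereal" where
  "lower_distr d f x y t = liminf (\<lambda>m. ereal (close_freq d f x y t m))"

definition upper_distr ::
    "('a \<Rightarrow> 'a \<Rightarrow> real) \<Rightarrow> ('a \<Rightarrow> 'a) \<Rightarrow> 'a \<Rightarrow> 'a \<Rightarrow> real \<Rightarrow> ereal" where
  "upper_distr d f x y t = limsup (\<lambda>m. ereal (close_freq d f x y t m))"

definition DC1_scrambled :: "('a \<Rightarrow> 'a \<Rightarrow> real) \<Rightarrow> ('a \<Rightarrow> 'a) \<Rightarrow> 'a \<Rightarrow> 'a \<Rightarrow> bool" where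
  "DC1_scrambled d f x y \<longleftrightarrow>
    (\<forall>t>0. upper_distr d f x y t = 1) \<and> (\<exists>s>0. lower_distr d f x y s = 0)"

definition DC2_scrambled :: "('a \<Rightarrow> 'a \<Rightarrow> real) \<Rightarrow> ('a \<Rightarrow> 'a) \<Rightarrow> 'a \<Rightarrow> 'a \<Rightarrow> bool" where
  "DC2_scrambled d f x y \<longleftrightarrow>
    (\<forall>t>0. upper_distr d f x y t = 1) \<and> (\<exists>s>0. lower_distr d f x y s < 1)"

definition DC1_chaotic :: "('a \<Rightarrow> 'a \<Rightarrow> real) \<Rightarrow> 'a set \<Rightarrow> ('a \<Rightarrow> 'a) \<Rightarrow> bool" where
  "DC1_chaotic d X f \<longleftrightarrow>
    (\<exists>S\<subseteq>X. uncountable S \<and> (\<forall>x\<in>S. \<forall>y\<in>S. x \<noteq> y \<longrightarrow> DC1_scrambled d f x y))"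

definition DC2_chaotic :: "('a \<Rightarrow> 'a \<Rightarrow> real) \<Rightarrow> 'a set \<Rightarrow> ('a \<Rightarrow> 'a) \<Rightarrow> bool" where
  "DC2_chaotic d X f \<longleftrightarrow>
    (\<exists>S\<subseteq>X. uncountable S \<and> (\<forall>x\<in>S. \<forall>y\<in>S. x \<noteq> y \<longrightarrow> DC2_scrambled d f x y))"

end

theory Submission
  imports Defs
begin

text \<open>
  If \<open>P\<close> misses a set \<open>Q\<close> of differences such that every finite colouring of a long interval has two
  points of equal colour with difference in \<open>Q\<close>, then any two points of the shift are simultaneously
  \<open>0\<close> on windows of any given length that occur with bounded gaps: otherwise colour \<open>n\<close> by the offset
  and the owner of the next symbol \<open>1\<close>. This gives proximality and excludes DC1-scrambled pairs.
  Positive entropy and DC2-chaos only need sets of positive density without differences in \<open>Q\<close>.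
  That both are possible is due to Kriz.

  Let \<open>Q\<close> be the union over \<open>j\<close> of the differences of sums of powers of two over disjoint subsets
  \<open>A\<close>, \<open>B\<close> of a block \<open>I\<^sub>j\<close> of very sparse binary positions, where \<open>A \<union> B\<close> omits at most \<open>j\<close> positions.
  The colouring property is a statement of Kneser type and follows from the octahedral Tucker lemma.
  Conversely, adding such a difference flips almost all digits in \<open>I\<^sub>j\<close> and, up to rare carries, no
  other digit. Outside a set of density at most \<open>1/2\<close> it therefore flips the majority digit of \<open>I\<^sub>j\<close> and
  preserves those of the other blocks, so that fixing the parity of the number of majority digits \<open>1\<close>
  yields sets of density at least \<open>1/4\<close> without differences in \<open>Q\<close>. Finally, \<open>Q\<close> has long gaps, which gives
  weak mixing.
\<close>


section \<open>The octahedral Tucker lemma\<close>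

primrec alternates :: "bool \<Rightarrow> bool list \<Rightarrow> bool" where
  "alternates s [] = True"
| "alternates s (b # bs) = (b = s \<and> alternates (\<not> s) bs)"

definition remove_nth :: "nat \<Rightarrow> 'a list \<Rightarrow> 'a list" where
  "remove_nth i xs = take i xs @ drop (Suc i) xs"

text \<open>A nonempty alternating word has exactly one such deletion, at an end determined by
  \<open>s\<close>. Any other word has none or two, the two being the letters of its only pair of
  equal neighbours. The parity does not depend on \<open>s\<close>, so the induction may pass from
  \<open>s\<close> to its negation.\<close>

lemma odd_card_alternates_remove_nth:
  "odd (card {i. i < length bs \<and> alternates s (remove_nth i bs)})
    \<longleftrightarrow> alternates True bs \<noteq> alternates False bs"
proof (induction bs arbitrary: s)
  case Nil
  then show ?case by simp
next
  case (Cons b bs)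
  let ?A = "{i. i < length bs \<and> b = s \<and> alternates (\<not> s) (remove_nth i bs)}"
  have split: "{i. i < length (b # bs) \<and> alternates s (remove_nth i (b # bs))}
     = {i. i = 0 \<and> alternates s bs} \<union> Suc ` ?A" (is "?L = ?R")
  proof (rule set_eqI)
    fix i show "i \<in> ?L \<longleftrightarrow> i \<in> ?R"
      by (cases i) (auto simp: remove_nth_def)
  qed
  have "card ({i. i = 0 \<and> alternates s bs} \<union> Suc ` ?A)
      = card {i. i = (0::nat) \<and> alternates s bs} + card (Suc ` ?A)"
    by (rule card_Un_disjoint) auto
  also have "card (Suc ` ?A) = card ?A"
    by (rule card_image) simp
  finally have "card {i. i < length (b # bs) \<and> alternates s (remove_nth i (b # bs))}
     = (if alternates s bs then 1 else 0) + card ?A"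
    unfolding split by simp
  then show ?case
    using Cons.IH[of "\<not> s"] by (cases s; cases b) auto
qed

lemma mset_remove_nth:
  assumes "i < length xs"
  shows "mset (remove_nth i xs) = mset xs - {# xs ! i #}"
proof -
  have "mset xs = mset (take i xs @ xs ! i # drop (Suc i) xs)"
    using assms by (simp add: id_take_nth_drop[symmetric])
  then show ?thesis by (simp add: remove_nth_def)
qed

lemma sorted_remove_nth: "sorted xs \<Longrightarrow> sorted (remove_nth i xs)"
proof -
  assume "sorted xs"
  then have "sorted (take i xs @ drop i xs)" by simp
  then have "\<forall>x\<in>set (take i xs). \<forall>y\<in>set (drop i xs). x \<le> y"
    unfolding sorted_append by simp
  moreover have "set (drop (Suc i) xs) \<subseteq> set (drop i xs)"
    by (rule set_drop_subset_set_drop) simp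
  ultimately show ?thesis
    using \<open>sorted xs\<close>
    by (simp add: remove_nth_def sorted_append sorted_wrt_drop sorted_wrt_take subset_iff)
qed

lemma map_remove_nth: "map f (remove_nth i xs) = remove_nth i (map f xs)"
  by (simp add: remove_nth_def take_map drop_map)

text \<open>The count depends only on the multiset of entries, so the list may be sorted first;
  deleting from a sorted list leaves it sorted.\<close>

lemma odd_card_alternates_sort_remove_nth:
  fixes vs :: "nat list"
  shows "odd (card {i. i < length vs \<and> alternates s (map odd (sort (remove_nth i vs)))})
    \<longleftrightarrow> alternates True (map odd (sort vs)) \<noteq> alternates False (map odd (sort vs))"
proof -
  define g :: "nat multiset \<Rightarrow> nat" where "g M = (if alternates s (map odd (sorted_list_of_multiset M)) then 1 else 0)" for M
  have count: "card {i. i < length ws \<and> alternates s (map odd (sort (remove_nth i ws)))}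
      = (\<Sum>v\<in>#mset ws. g (mset ws - {#v#}))" for ws :: "nat list"
  proof -
    have "(\<Sum>v\<in>#mset ws. g (mset ws - {#v#})) = sum_list (map (\<lambda>v. g (mset ws - {#v#})) ws)"
      by (simp add: sum_mset_sum_list[symmetric])
    also have "\<dots> = (\<Sum>i<length ws. g (mset ws - {#ws ! i#}))"
      by (simp add: sum_list_sum_nth atLeast0LessThan)
    also have "\<dots> = (\<Sum>i<length ws. if alternates s (map odd (sort (remove_nth i ws))) then 1 else 0)"
      by (rule sum.cong) (auto simp: g_def mset_remove_nth[symmetric])
    also have "\<dots> = card {i. i < length ws \<and> alternates s (map odd (sort (remove_nth i ws)))}"
      by (simp add: sum.If_cases Int_def)
    finally show ?thesis ..
  qed
  have "card {i. i < length vs \<and> alternates s (map odd (sort (remove_nth i vs)))}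
      = card {i. i < length (sort vs) \<and> alternates s (map odd (sort (remove_nth i (sort vs))))}"
    by (simp only: count mset_sort)
  also have "\<dots> = card {i. i < length (map odd (sort vs)) \<and> alternates s (remove_nth i (map odd (sort vs)))}"
    by (intro arg_cong[where f = card]) (auto simp: sorted_sort_id sorted_remove_nth map_remove_nth)
  finally show ?thesis by (simp only: odd_card_alternates_remove_nth)
qed

lemma even_card_involution:
  assumes "finite A" and "\<And>x. x \<in> A \<Longrightarrow> f x \<in> A \<and> f x \<noteq> x \<and> f (f x) = x"
  shows "even (card A)"
  using assms
proof (induction "card A" arbitrary: A rule: less_induct)
  case less
  show ?case
  proof (cases "A = {}")
    case False
    then obtain a where a: "a \<in> A" by auto
    let ?B = "A - {a, f a}"
    have fa: "f a \<in> A" "f a \<noteq> a" "f (f a) = a" using less.prems(2)[OF a] by auto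
    have sub: "{a, f a} \<subseteq> A" using a fa by simp
    have two: "card {a, f a} = 2" using fa by simp
    have "card {a, f a} \<le> card A" using sub less.prems(1) by (rule card_mono[rotated])
    moreover have "card ?B = card A - card {a, f a}"
      using sub by (intro card_Diff_subset) auto
    ultimately have *: "card A = card ?B + 2" using two by simp
    have "f x \<in> ?B \<and> f x \<noteq> x \<and> f (f x) = x" if "x \<in> ?B" for x
    proof -
      have "x \<in> A" "x \<noteq> a" "x \<noteq> f a" using that by auto
      moreover from this have "f x \<in> A" "f x \<noteq> x" "f (f x) = x" using less.prems(2) by auto
      ultimately show ?thesis using fa by force
    qed
    then have "even (card ?B)"
      using * less.prems(1) by (intro less.hyps) auto
    with * show ?thesis by simp
  qed simp
qed

section \<open>Signs and codes of labels\<close>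

definition negate :: "nat \<times> bool \<Rightarrow> nat \<times> bool" where
  "negate l = (fst l, \<not> snd l)"

text \<open>
  A signed label \<open>\<plusminus>a\<close> is coded as \<open>2 * a + 1\<close> or \<open>2 * a\<close>, so the parity of a code is its sign.
\<close>

definition flip_code :: "nat \<Rightarrow> nat" where
  "flip_code v = (if even v then Suc v else v - 1)"

lemma flip_code_flip_code [simp]: "flip_code (flip_code v) = v"
  by (auto simp: flip_code_def elim: oddE)

lemma odd_flip_code [simp]: "odd (flip_code v) \<longleftrightarrow> even v"
  by (auto simp: flip_code_def elim: oddE)

text \<open>\<open>flip_code\<close> exchanges \<open>2 * a\<close> and \<open>2 * a + 1\<close>, so
  it can reverse the order only inside such a pair.\<close>

lemma flip_code_mono: "x \<le> y \<Longrightarrow> x \<noteq> flip_code y \<Longrightarrow> flip_code x \<le> flip_code y"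
  unfolding flip_code_def by presburger

lemma sort_map_flip_code:
  assumes "\<And>x y. x \<in> set vs \<Longrightarrow> y \<in> set vs \<Longrightarrow> x \<noteq> flip_code y"
  shows "sort (map flip_code vs) = map flip_code (sort vs)"
proof (rule properties_for_sort)
  show "mset (map flip_code (sort vs)) = mset (map flip_code vs)" by simp
  have "sorted_wrt (\<lambda>x y. flip_code x \<le> flip_code y) (sort vs)"
    by (rule sorted_wrt_mono_rel[of _ "(\<le>)"]) (use assms flip_code_mono in auto)
  then show "sorted (map flip_code (sort vs))" by (simp add: sorted_wrt_map)
qed

lemma alternates_map_Not: "alternates s (map Not bs) \<longleftrightarrow> alternates (\<not> s) bs"
  by (induction bs arbitrary: s) auto

text \<open>Neighbours have different signs, so equal absolute values would make them
  complementary.\<close>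

lemma sorted_alternates_imp_strict:
  assumes "sorted vs" "alternates s (map odd vs)"
    and "\<And>x y. x \<in> set vs \<Longrightarrow> y \<in> set vs \<Longrightarrow> x \<noteq> flip_code y"
  shows "sorted_wrt (<) (map (\<lambda>v. v div 2) vs)"
  using assms
proof (induction vs arbitrary: s)
  case (Cons a vs)
  have IH: "sorted_wrt (<) (map (\<lambda>v. v div 2) vs)"
    using Cons.prems by (intro Cons.IH[of "\<not> s"]) auto
  show ?case
  proof (cases vs)
    case (Cons b ws)
    have "a \<le> b" "odd a \<noteq> odd b" "a \<noteq> flip_code b"
      using Cons.prems unfolding Cons by auto
    then have "a div 2 < b div 2" unfolding flip_code_def by presburger
    moreover have "b div 2 \<le> v div 2" if "v \<in> set vs" for v
      using that Cons.prems(1) unfolding Cons by (auto intro: div_le_mono)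
    ultimately show ?thesis using IH by fastforce
  qed simp
qed simp

text \<open>
  A list of literals with distinct variables encodes a maximal chain of sign vectors, namely the
  sets of literals in its initial segments.
\<close>

definition flags :: "nat \<Rightarrow> (nat \<times> bool) list set" where
  "flags k = {ls. distinct (map fst ls) \<and> fst ` set ls = {..<k}}"

lemma length_flags: "ls \<in> flags k \<Longrightarrow> length ls = k"
  unfolding flags_def by (metis (mono_tags, lifting) card_lessThan distinct_card length_map list.set_map mem_Collect_eq)

lemma finite_flags: "finite (flags k)"
proof (rule finite_subset)
  show "flags k \<subseteq> {ls. set ls \<subseteq> {..<k} \<times> UNIV \<and> length ls = k}"
  proof
    fix ls assume "ls \<in> flags k"
    then show "ls \<in> {ls. set ls \<subseteq> {..<k} \<times> UNIV \<and> length ls = k}"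
      using length_flags[of ls k] by (auto simp: flags_def) (metis fst_conv image_eqI lessThan_iff)
  qed
  show "finite {ls :: (nat \<times> bool) list. set ls \<subseteq> {..<k} \<times> UNIV \<and> length ls = k}"
    by (rule finite_lists_length_eq) simp
qed

lemma flags_map_negate: "map negate ls \<in> flags k \<longleftrightarrow> ls \<in> flags k"
  by (simp add: flags_def negate_def image_image o_def)

lemma negate_negate [simp]: "negate (negate l) = l"
  by (simp add: negate_def)

section \<open>Neighbouring flags and the labels of their vertices\<close>

definition swap_next :: "nat \<Rightarrow> 'a list \<Rightarrow> 'a list" where
  "swap_next i ls = ls[i := ls ! Suc i, Suc i := ls ! i]"

text \<open>The swap replaces only one vertex of the chain; it is the pivot across the facet
  opposite to vertex \<open>i\<close>.\<close>

lemma set_take_swap_next: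
  assumes "Suc i < length ls" "j \<noteq> i"
  shows "set (take (Suc j) (swap_next i ls)) = set (take (Suc j) ls)"
proof (cases "j < i")
  case True
  then show ?thesis by (simp add: swap_next_def)
next
  case False
  then have "i < length (take (Suc j) ls)" "Suc i < length (take (Suc j) ls)"
    using assms by auto
  moreover have "take (Suc j) (swap_next i ls)
      = (take (Suc j) ls)[i := take (Suc j) ls ! Suc i, Suc i := take (Suc j) ls ! i]"
    using False assms by (simp add: swap_next_def take_update_swap)
  ultimately show ?thesis by (metis set_swap)
qed

lemma swap_next_flags:
  assumes "ls \<in> flags k" "Suc i < k"
  shows "swap_next i ls \<in> flags k" and "swap_next i ls \<noteq> ls"
    and "swap_next i (swap_next i ls) = ls" and "set (swap_next i ls) = set ls"
proof -
  have len: "length ls = k" using assms length_flags by blast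
  show set: "set (swap_next i ls) = set ls"
    using assms len by (simp add: swap_next_def set_swap)
  have d: "distinct (map fst ls)" using assms by (simp add: flags_def)
  have "map fst (swap_next i ls) = (map fst ls)[i := map fst ls ! Suc i, Suc i := map fst ls ! i]"
    using assms len by (simp add: swap_next_def map_update)
  then have "distinct (map fst (swap_next i ls))"
    using d assms len by (metis Suc_lessD distinct_swap length_map)
  then show "swap_next i ls \<in> flags k" using assms set by (simp add: flags_def)
  have "ls ! i \<noteq> ls ! Suc i"
    using nth_eq_iff_index_eq[OF d, of i "Suc i"] assms len by auto
  then show "swap_next i ls \<noteq> ls"
    using assms len by (auto simp: swap_next_def list_eq_iff_nth_eq nth_list_update)
  show "swap_next i (swap_next i ls) = ls"
    using assms len by (intro nth_equalityI) (auto simp: swap_next_def nth_list_update)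
qed

definition labels :: "((nat \<times> bool) set \<Rightarrow> nat) \<Rightarrow> (nat \<times> bool) list \<Rightarrow> nat list" where
  "labels lam ls = map (\<lambda>j. lam (set (take (Suc j) ls))) [0..<length ls]"

lemma length_labels [simp]: "length (labels lam ls) = length ls"
  by (simp add: labels_def)

lemma nth_labels: "j < length ls \<Longrightarrow> labels lam ls ! j = lam (set (take (Suc j) ls))"
  by (simp add: labels_def)

lemma remove_nth_cong:
  assumes "length xs = length ys" "\<And>j. j < length xs \<Longrightarrow> j \<noteq> i \<Longrightarrow> xs ! j = ys ! j"
  shows "remove_nth i xs = remove_nth i ys"
  unfolding remove_nth_def
  using assms by (intro arg_cong2[where f = "(@)"] nth_equalityI) auto

text \<open>The nonzero vectors with entries -1, 0, 1, coded as the sets of their signed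
  coordinates. They are the proper faces of the cross-polytope, and inclusion is the face
  order.\<close>

definition sign_vectors :: "nat \<Rightarrow> (nat \<times> bool) set set" where
  "sign_vectors n = {X. X \<noteq> {} \<and> inj_on fst X \<and> fst ` X \<subseteq> {..<n}}"

lemma set_take_flag_sign_vector:
  assumes "ls \<in> flags k" "k \<le> n" "j < length ls"
  shows "set (take (Suc j) ls) \<in> sign_vectors n"
proof -
  have "set (take (Suc j) ls) \<subseteq> set ls" by (rule set_take_subset)
  moreover have "inj_on fst (set ls)" "fst ` set ls \<subseteq> {..<n}"
    using assms by (auto simp: flags_def distinct_map)
  ultimately show ?thesis
    using assms(3) by (auto simp: sign_vectors_def intro: inj_on_subset)
qed

section \<open>Parity induction over hemispheres\<close>

locale octahedral_labelling =
  fixes n :: nat and lam :: "(nat \<times> bool) set \<Rightarrow> nat"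
  assumes antipodal: "X \<in> sign_vectors n \<Longrightarrow> lam (negate ` X) = flip_code (lam X)"
    and not_complementary:
      "X \<in> sign_vectors n \<Longrightarrow> Y \<in> sign_vectors n \<Longrightarrow> X \<subseteq> Y \<Longrightarrow> lam X \<noteq> flip_code (lam Y)"
begin

text \<open>Sorting the codes orders the labels by absolute value; \<open>s\<close> is the sign
  required of the smallest one, with \<open>True\<close> for positive. A \<open>door\<close> is a
  facet of the flag that alternates and starts positively.\<close>

definition alternating :: "bool \<Rightarrow> (nat \<times> bool) list \<Rightarrow> bool" where
  "alternating s ls \<longleftrightarrow> alternates s (map odd (sort (labels lam ls)))"

definition door :: "nat \<Rightarrow> (nat \<times> bool) list \<Rightarrow> bool" where
  "door i ls \<longleftrightarrow> alternates True (map odd (sort (remove_nth i (labels lam ls))))"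

lemma labels_not_complementary:
  assumes "ls \<in> flags k" "k \<le> n" "x \<in> set (labels lam ls)" "y \<in> set (labels lam ls)"
  shows "x \<noteq> flip_code y"
proof -
  obtain i j where ij: "i < length ls" "j < length ls"
      "x = lam (set (take (Suc i) ls))" "y = lam (set (take (Suc j) ls))"
    using assms(3,4) by (auto simp: labels_def)
  have sv: "set (take (Suc i) ls) \<in> sign_vectors n" "set (take (Suc j) ls) \<in> sign_vectors n"
    using set_take_flag_sign_vector assms ij by blast+
  show ?thesis
  proof (cases "i \<le> j")
    case True
    then have "set (take (Suc i) ls) \<subseteq> set (take (Suc j) ls)"
      by (intro set_take_subset_set_take) simp
    then show ?thesis using not_complementary sv ij by metis
  next
    case False
    then have "set (take (Suc j) ls) \<subseteq> set (take (Suc i) ls)"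
      by (intro set_take_subset_set_take) simp
    then show ?thesis using not_complementary sv ij by (metis flip_code_flip_code)
  qed
qed

text \<open>The antipode flips every label. As no two labels of a flag are complementary, their
  order survives and only the signs change.\<close>

lemma alternating_map_negate:
  assumes "ls \<in> flags k" "k \<le> n"
  shows "alternating s (map negate ls) \<longleftrightarrow> alternating (\<not> s) ls"
proof -
  have "labels lam (map negate ls) = map flip_code (labels lam ls)"
    using antipodal set_take_flag_sign_vector[OF assms]
    by (intro nth_equalityI) (simp_all add: nth_labels take_map)
  moreover have "sort (map flip_code (labels lam ls)) = map flip_code (sort (labels lam ls))"
    using labels_not_complementary[OF assms] by (intro sort_map_flip_code) auto
  moreover have "map odd (map flip_code vs) = map Not (map odd vs)" for vs
    by (simp add: o_def)
  ultimately show ?thesis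
    unfolding alternating_def by (metis alternates_map_Not)
qed

lemma odd_card_doors:
  "odd (card {i. i < length ls \<and> door i ls}) \<longleftrightarrow> alternating True ls \<noteq> alternating False ls"
  using odd_card_alternates_sort_remove_nth[of "labels lam ls" True]
  by (simp add: door_def alternating_def)

text \<open>The only label affected by the swap is the one that door \<open>i\<close>
  ignores.\<close>

lemma door_swap_next: "Suc i < length ls \<Longrightarrow> door i (swap_next i ls) \<longleftrightarrow> door i ls"
  unfolding door_def
  by (subst remove_nth_cong[of _ "labels lam ls"])
     (auto simp: nth_labels set_take_swap_next, simp_all add: swap_next_def nth_labels)

lemma door_last_cong:
  assumes "length ls = Suc k" "length ls' = Suc k" "take k ls = take k ls'"
  shows "door k ls \<longleftrightarrow> door k ls'"
proof -
  have "take (Suc j) ls = take (Suc j) ls'" if "j < k" for j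
    using arg_cong[OF assms(3), of "take (Suc j)"] that by (simp add: min_def)
  then show ?thesis
    unfolding door_def using assms
    by (subst remove_nth_cong[of _ "labels lam ls'"]) (auto simp: nth_labels)
qed

lemma door_append: "door (length ls) (ls @ [l]) \<longleftrightarrow> alternating True ls"
proof -
  have "remove_nth (length ls) (labels lam (ls @ [l])) = labels lam ls"
    by (rule nth_equalityI) (auto simp: remove_nth_def labels_def nth_append)
  then show ?thesis by (simp add: door_def alternating_def)
qed

text \<open>The hemisphere on which coordinate \<open>k\<close> ends up positive. Its boundary
  facets arise by dropping the last literal from the flags that end in
  \<open>(k, True)\<close>.\<close>

definition upper :: "nat \<Rightarrow> (nat \<times> bool) list set" where
  "upper k = {ls \<in> flags (Suc k). (k, True) \<in> set ls}"

lemma upper_last: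
  assumes "ls \<in> upper k" "fst (ls ! k) = k"
  shows "ls ! k = (k, True)"
proof -
  have "inj_on fst (set ls)" "ls ! k \<in> set ls" "(k, True) \<in> set ls"
    using assms length_flags[of ls "Suc k"] by (auto simp: upper_def flags_def distinct_map)
  with assms(2) show ?thesis by (metis fst_conv inj_onD)
qed

lemma upper_not_last:
  assumes ls: "ls \<in> upper k" and ne: "ls ! k \<noteq> (k, True)"
  defines "ls' \<equiv> ls[k := negate (ls ! k)]"
  shows "ls' \<in> upper k" "ls' ! k \<noteq> (k, True)" "ls' \<noteq> ls" "ls'[k := negate (ls' ! k)] = ls"
    "take k ls' = take k ls"
proof -
  have fl: "ls \<in> flags (Suc k)" and mem: "(k, True) \<in> set ls" using ls by (auto simp: upper_def)
  have len: "length ls = Suc k" using length_flags fl by blast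
  have nk: "fst (ls ! k) \<noteq> k" using upper_last ls ne by blast
  obtain i where i: "i < length ls" "ls ! i = (k, True)" using mem by (metis in_set_conv_nth)
  have "map fst ls' = map fst ls"
    using len by (auto simp: ls'_def map_update negate_def intro!: nth_equalityI simp: nth_list_update)
  moreover have "fst ` set ls' = fst ` set ls"
    using calculation by (metis list.set_map)
  ultimately have "ls' \<in> flags (Suc k)" using fl by (simp add: flags_def)
  moreover have "ls' ! i = (k, True)"
    using i ne by (metis ls'_def nth_list_update_neq)
  then have "(k, True) \<in> set ls'" using i by (metis ls'_def length_list_update nth_mem)
  ultimately show "ls' \<in> upper k" by (simp add: upper_def)
  show "ls' ! k \<noteq> (k, True)" "ls' \<noteq> ls" "ls'[k := negate (ls' ! k)] = ls" "take k ls' = take k ls"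
    using len nk
    by (auto simp: ls'_def negate_def list_eq_iff_nth_eq nth_list_update intro!: exI[of _ k])
      (metis snd_conv)
qed

text \<open>This identifies the boundary of the hemisphere with the sphere one dimension
  lower.\<close>

lemma flags_append: "ls @ [(k, True)] \<in> upper k \<longleftrightarrow> ls \<in> flags k"
proof
  assume "ls \<in> flags k"
  then show "ls @ [(k, True)] \<in> upper k"
    by (auto simp: upper_def flags_def)
next
  assume "ls @ [(k, True)] \<in> upper k"
  then have *: "distinct (map fst ls)" "k \<notin> fst ` set ls" "insert k (fst ` set ls) = {..<Suc k}"
    by (auto simp: upper_def flags_def)
  then have "fst ` set ls = {..<Suc k} - {k}" by auto
  then show "ls \<in> flags k" using * by (auto simp: flags_def lessThan_Suc)
qed

text \<open>
  A door away from the boundary is shared by exactly two flags of the upper hemisphere: swapping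
  two neighbours, or negating the last literal, exchanges them.
\<close>

lemma even_card_inner_doors:
  "even (card {p \<in> upper k \<times> {..<Suc k}. door (snd p) (fst p) \<and> p \<noteq> (butlast (fst p) @ [(k, True)], k)})"
    (is "even (card ?D)")
proof (rule even_card_involution)
  let ?f = "\<lambda>(ls, i). if i < k then (swap_next i ls, i) else (ls[k := negate (ls ! k)], k)"
  show "finite ?D"
    by (rule finite_subset[of _ "flags (Suc k) \<times> {..<Suc k}"]) (auto simp: upper_def finite_flags)
  fix p assume p: "p \<in> ?D"
  obtain ls i where [simp]: "p = (ls, i)" by (cases p)
  have ls: "ls \<in> upper k" "ls \<in> flags (Suc k)" "i \<le> k" "door i ls"
    using p by (auto simp: upper_def)
  have len: "length ls = Suc k" using ls length_flags by blast
  show "?f p \<in> ?D \<and> ?f p \<noteq> p \<and> ?f (?f p) = p"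
  proof (cases "i < k")
    case True
    then have "Suc i < Suc k" by simp
    from swap_next_flags[OF ls(2) this] True ls door_swap_next[of i ls] len
    show ?thesis by (auto simp: upper_def)
  next
    case False
    then have ik: "i = k" using ls by simp
    \<comment> \<open>The pairs left out of the count are the boundary doors: \<open>i = k\<close>
      and the flag ends in \<open>(k, True)\<close>. Negating the last literal never leads to one of
      them.\<close>
    have bl: "butlast ls' @ [(k, True)] = ls' \<longleftrightarrow> ls' ! k = (k, True)" if "length ls' = Suc k" for ls'
      using that by (cases ls' rule: rev_cases) (auto simp: nth_append)
    have "ls ! k \<noteq> (k, True)" using p bl[OF len] ik by auto
    note u = upper_not_last[OF ls(1) this]
    have "door k (ls[k := negate (ls ! k)])"
      using door_last_cong[of ls k] ls(4) ik len u(5) by (metis length_list_update)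
    then show ?thesis using u ik bl[of "ls[k := negate (ls ! k)]"] len by auto
  qed
qed

text \<open>The positive alternating flags of the lower hemisphere are antipodes of the negative
  ones of the upper, so it suffices to count upper flags alternating with either sign. These are the
  ones with an odd number of doors. Inner doors pair up, and boundary doors correspond to the
  positive alternating flags one dimension lower.\<close>

lemma odd_card_alternating:
  "k \<le> n \<Longrightarrow> odd (card {ls \<in> flags k. alternating True ls})"
proof (induction k)
  case 0
  have "flags 0 = {[]}" by (auto simp: flags_def)
  moreover have "alternating True []" by (simp add: alternating_def labels_def)
  ultimately have "{ls \<in> flags 0. alternating True ls} = {[]}" by blast
  then show ?case by simp
next
  case (Suc k)
  let ?A = "\<lambda>s. {ls \<in> upper k. alternating s ls}"
  have fin: "finite (upper k)" using finite_flags by (simp add: upper_def)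
  have sgn: "(k, True) \<in> set ls \<longleftrightarrow> (k, False) \<notin> set ls" if "ls \<in> flags (Suc k)" for ls
  proof -
    have "inj_on fst (set ls)" "fst ` set ls = {..<Suc k}"
      using that by (auto simp: flags_def distinct_map)
    then have "\<exists>b. (k, b) \<in> set ls" by (metis (full_types) imageE lessI lessThan_iff prod.collapse)
    moreover have "\<not> ((k, True) \<in> set ls \<and> (k, False) \<in> set ls)"
      using \<open>inj_on fst (set ls)\<close> by (metis Pair_inject fst_conv inj_onD)
    ultimately show ?thesis by (metis (full_types))
  qed
  have low: "map negate ` ?A False = {ls \<in> flags (Suc k). (k, True) \<notin> set ls \<and> alternating True ls}"
    (is "_ = ?L")
  proof (intro equalityI subsetI)
    fix ls assume "ls \<in> map negate ` ?A False"
    then obtain ms where ms: "ms \<in> flags (Suc k)" "(k, True) \<in> set ms" "alternating False ms"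
       "ls = map negate ms" by (auto simp: upper_def)
    have "(k, False) \<in> set ls" using ms by (force simp: negate_def)
    moreover have fl: "ls \<in> flags (Suc k)" using ms by (simp add: flags_map_negate)
    moreover have "alternating True ls"
      using ms alternating_map_negate[of ms "Suc k"] Suc.prems by simp
    ultimately show "ls \<in> ?L" using sgn[OF fl] by blast
  next
    fix ls assume ls: "ls \<in> ?L"
    then have "(k, False) \<in> set ls" using sgn by blast
    then have "(k, True) \<in> set (map negate ls)" by (force simp: negate_def)
    moreover have "alternating False (map negate ls)"
      using ls alternating_map_negate[of ls "Suc k"] Suc.prems by auto
    moreover have "ls = map negate (map negate ls)" by (simp add: o_def)
    ultimately show "ls \<in> map negate ` ?A False"
      using ls by (intro image_eqI[of _ _ "map negate ls"]) (auto simp: upper_def flags_map_negate)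
  qed
  have "inj negate" by (rule injI) (metis negate_negate)
  then have "card (map negate ` ?A False) = card (?A False)"
    by (intro card_image inj_onI) (metis inj_map_eq_map)
  moreover have "{ls \<in> flags (Suc k). alternating True ls} = ?A True \<union> map negate ` ?A False"
    unfolding low by (auto simp: upper_def)
  moreover have "card (?A True \<union> map negate ` ?A False) = card (?A True) + card (map negate ` ?A False)"
    unfolding low using fin finite_flags by (intro card_Un_disjoint) (auto simp: upper_def)
  ultimately have "card {ls \<in> flags (Suc k). alternating True ls} = card (?A True) + card (?A False)"
    by simp
  also have "\<dots> = card (?A True \<union> ?A False)"
  proof (rule card_Un_disjoint[symmetric])
    have False if "ls \<in> upper k" "alternating True ls" "alternating False ls" for ls
    proof -
      have "sort (labels lam ls) \<noteq> []"
        using that length_flags[of ls "Suc k"]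
        by (metis (lifting) length_0_conv length_labels length_sort mem_Collect_eq nat.distinct(1) upper_def)
      then show False
        using that unfolding alternating_def by (cases "sort (labels lam ls)") auto
    qed
    then show "?A True \<inter> ?A False = {}" by auto
  qed (use fin in auto)
  also have "?A True \<union> ?A False = {ls \<in> upper k. odd (card {i. i < Suc k \<and> door i ls})}"
  proof -
    have "alternating True ls \<or> alternating False ls \<longleftrightarrow> odd (card {i. i < Suc k \<and> door i ls})"
      if "ls \<in> upper k" for ls
    proof -
      have len: "length ls = Suc k" using that length_flags by (auto simp: upper_def)
      then have "sort (labels lam ls) \<noteq> []"
        by (metis length_0_conv length_labels length_sort nat.distinct(1))
      then have "\<not> (alternating True ls \<and> alternating False ls)"
        unfolding alternating_def by (cases "sort (labels lam ls)") auto
      then show ?thesis using odd_card_doors[of ls] len by auto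
    qed
    then show ?thesis by auto
  qed
  finally have "odd (card {ls \<in> flags (Suc k). alternating True ls})
      \<longleftrightarrow> odd (\<Sum>ls\<in>upper k. card {i. i < Suc k \<and> door i ls})"
    by (simp add: even_sum_iff[OF fin])
  also have "(\<Sum>ls\<in>upper k. card {i. i < Suc k \<and> door i ls})
      = card (SIGMA ls:upper k. {i. i < Suc k \<and> door i ls})"
    using fin by (simp add: card_SigmaI)
  also have "(SIGMA ls:upper k. {i. i < Suc k \<and> door i ls})
      = {p \<in> upper k \<times> {..<Suc k}. door (snd p) (fst p) \<and> p \<noteq> (butlast (fst p) @ [(k, True)], k)}
        \<union> (\<lambda>ls. (ls @ [(k, True)], k)) ` {ls \<in> flags k. alternating True ls}"
    (is "_ = ?D \<union> ?B")
  proof -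
    have "(ls, k) \<in> ?B" if "ls \<in> upper k" "door k ls" "ls = butlast ls @ [(k, True)]" for ls
    proof -
      have "length (butlast ls) = k" using that(1) length_flags[of ls "Suc k"] by (auto simp: upper_def)
      then have "butlast ls \<in> flags k" "alternating True (butlast ls)"
        using that flags_append door_append by metis+
      then show ?thesis using that(3) by blast
    qed
    moreover have "ls @ [(k, True)] \<in> upper k \<and> door k (ls @ [(k, True)])"
      if "ls \<in> flags k" "alternating True ls" for ls
      using that flags_append door_append[of ls] length_flags[of ls k] by auto
    ultimately show ?thesis by fastforce
  qed
  also have "card (?D \<union> ?B) = card ?D + card ?B"
  proof (rule card_Un_disjoint)
    show "finite ?D"
      by (rule finite_subset[of _ "upper k \<times> {..<Suc k}"]) (use fin in auto)
    show "finite ?B" using finite_flags by auto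
  qed auto
  also have "card ?B = card {ls \<in> flags k. alternating True ls}"
    by (rule card_image) (auto intro: inj_onI)
  finally show ?case
    using even_card_inner_doors[of k] Suc by simp
qed

text \<open>An odd number of positive alternating flags means that one exists, and its
  \<open>n\<close> labels have distinct absolute values.\<close>

lemma tucker: "n \<le> card ((\<lambda>X. lam X div 2) ` sign_vectors n)"
proof -
  have "{ls \<in> flags n. alternating True ls} \<noteq> {}"
    using odd_card_alternating[of n] by (metis card.empty dvd_0_right order_refl)
  then obtain ls where ls: "ls \<in> flags n" "alternating True ls" by auto
  have "sorted_wrt (<) (map (\<lambda>v. v div 2) (sort (labels lam ls)))"
    using ls labels_not_complementary[of ls n]
    by (intro sorted_alternates_imp_strict[where s = True]) (auto simp: alternating_def)
  then have "distinct (map (\<lambda>v. v div 2) (sort (labels lam ls)))"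
    by (simp add: strict_sorted_iff)
  then have "card ((\<lambda>v. v div 2) ` set (labels lam ls)) = n"
    using distinct_card length_flags[OF ls(1)] by fastforce
  moreover have "set (labels lam ls) \<subseteq> lam ` sign_vectors n"
    using set_take_flag_sign_vector[OF ls(1)] by (auto simp: labels_def)
  then have "(\<lambda>v. v div 2) ` set (labels lam ls) \<subseteq> (\<lambda>X. lam X div 2) ` sign_vectors n"
    by auto
  moreover have "sign_vectors n \<subseteq> Pow ({..<n} \<times> UNIV)" by (auto simp: sign_vectors_def)
  then have "finite (sign_vectors n)" by (rule finite_subset) simp
  ultimately show ?thesis by (metis card_mono finite_imageI)
qed

end

section \<open>Monochromatic disjoint sets\<close>

lemma finite_sign_vector: "X \<in> sign_vectors n \<Longrightarrow> finite X"
  unfolding sign_vectors_def using finite_subset[OF _ finite_lessThan] finite_imageD by blast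

text \<open>
  Small sign vectors are labelled by their size, with the sign of the least variable; a large one is
  labelled by the smaller of the colours of its positive and its negative part, and these
  differ if the colouring is proper.
\<close>

lemma octahedral_labelling_colouring:
  fixes c :: "nat set \<Rightarrow> nat"
  assumes "t \<le> d"
    and proper: "\<forall>A B. A \<subseteq> {..<d} \<and> B \<subseteq> {..<d} \<and> A \<inter> B = {} \<and> t \<le> card A + card B \<longrightarrow> c A \<noteq> c B"
    and pos_def: "pos = (\<lambda>X :: (nat \<times> bool) set. {i. (i, True) \<in> X})"
    and neg_def: "neg = (\<lambda>X :: (nat \<times> bool) set. {i. (i, False) \<in> X})"
    and lam_def: "lam = (\<lambda>X. if card X < t then 2 * card X + of_bool ((Min (fst ` X), True) \<in> X)
      else 2 * (d + min (c (pos X)) (c (neg X))) + of_bool (c (pos X) < c (neg X)))"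
  shows "octahedral_labelling d lam"
    and "X \<in> sign_vectors d \<Longrightarrow> t \<le> card X \<Longrightarrow> c (pos X) \<noteq> c (neg X)"
    and "X \<in> sign_vectors d \<Longrightarrow> pos X \<subseteq> {..<d} \<and> neg X \<subseteq> {..<d}"
proof -
  have sub: "pos X \<subseteq> {..<d} \<and> neg X \<subseteq> {..<d}" and fin: "finite X"
    and disj: "pos X \<inter> neg X = {}"
    and card: "card X = card (pos X) + card (neg X)"
    and Min: "(Min (fst ` X), True) \<in> X \<longleftrightarrow> (Min (fst ` X), False) \<notin> X"
    if X: "X \<in> sign_vectors d" for X
  proof -
    have X': "X \<noteq> {}" "inj_on fst X" "fst ` X \<subseteq> {..<d}" using X by (auto simp: sign_vectors_def)
    show sub': "pos X \<subseteq> {..<d} \<and> neg X \<subseteq> {..<d}"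
      using X' by (force simp: pos_def neg_def)
    show fin': "finite X" using X by (rule finite_sign_vector)
    have one: "\<not> ((i, True) \<in> X \<and> (i, False) \<in> X)" for i
      using X'(2) by (metis Pair_inject fst_conv inj_onD)
    then show disj': "pos X \<inter> neg X = {}" by (auto simp: pos_def neg_def)
    have "fst ` X = pos X \<union> neg X"
    proof (intro equalityI subsetI)
      fix i assume "i \<in> fst ` X"
      then obtain b where "(i, b) \<in> X" by auto
      then show "i \<in> pos X \<union> neg X" by (cases b) (auto simp: pos_def neg_def)
    qed (force simp: pos_def neg_def)
    moreover have "finite (pos X)" "finite (neg X)" using sub' finite_subset by auto
    ultimately show "card X = card (pos X) + card (neg X)"
      using disj' X'(2) by (metis card_Un_disjoint card_image)
    have "Min (fst ` X) \<in> fst ` X" using X' fin' by (intro Min_in) auto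
    then obtain b where "(Min (fst ` X), b) \<in> X" by auto
    then show "(Min (fst ` X), True) \<in> X \<longleftrightarrow> (Min (fst ` X), False) \<notin> X"
      using one by (cases b) auto
  qed
  show "X \<in> sign_vectors d \<Longrightarrow> pos X \<subseteq> {..<d} \<and> neg X \<subseteq> {..<d}" for X using sub by blast
  show ne: "c (pos X) \<noteq> c (neg X)" if "X \<in> sign_vectors d" "t \<le> card X" for X
    using proper[rule_format, of "pos X" "neg X"] sub disj card that by auto
  show "octahedral_labelling d lam"
  proof
    fix X assume X: "X \<in> sign_vectors d"
    have "inj negate" by (rule injI) (metis negate_negate)
    then have cX: "card (negate ` X) = card X" by (meson card_image inj_on_subset subset_UNIV)
    have mem: "(i, b) \<in> negate ` X \<longleftrightarrow> (i, \<not> b) \<in> X" for i b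
      by (force simp: negate_def)
    have pn: "pos (negate ` X) = neg X" "neg (negate ` X) = pos X"
      by (auto simp: pos_def neg_def mem)
    have fst: "fst ` negate ` X = fst ` X" by (simp add: image_image negate_def)
    show "lam (negate ` X) = flip_code (lam X)"
    proof (cases "card X < t")
      case True
      then show ?thesis using Min[OF X] by (simp add: lam_def cX fst mem flip_code_def)
    next
      case False
      then have "c (pos X) < c (neg X) \<longleftrightarrow> \<not> c (neg X) < c (pos X)" using ne[OF X] by linarith
      then show ?thesis using False by (simp add: lam_def cX pn flip_code_def min.commute)
    qed
  next
    fix X Y assume X: "X \<in> sign_vectors d" and Y: "Y \<in> sign_vectors d" and XY: "X \<subseteq> Y"
    have flip: "u div 2 = v div 2" if "u = flip_code v" for u v
      using that unfolding flip_code_def by presburger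
    have high: "lam X div 2 = d + min (c (pos X)) (c (neg X))" if "t \<le> card X" for X
    proof -
      have "(2 * a + of_bool b) div 2 = a" for a :: nat and b by (cases b) auto
      then show ?thesis using that unfolding lam_def by (simp only: not_le[symmetric] not_not if_False simp_thms)
    qed
    have cXY: "card X \<le> card Y" using XY fin[OF Y] by (simp add: card_mono)
    show "lam X \<noteq> flip_code (lam Y)"
    proof
      assume eq: "lam X = flip_code (lam Y)"
      from flip[OF this] have lev: "lam X div 2 = lam Y div 2" .
      have self: "v \<noteq> flip_code v" for v unfolding flip_code_def by presburger
      \<comment> \<open>Two small vectors of equal level have equal size and coincide. A small and a
        large one have levels on different sides of \<open>d\<close>. For two large ones, equal
        minima with opposite signs give the positive part of one the colour of the negative part of
        the other, and such parts are disjoint and jointly large.\<close>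
      consider "card Y < t" | "card X < t" "t \<le> card Y" | "t \<le> card X" using cXY by linarith
      then show False
      proof cases
        case 1
        then have "card X = card Y" using lev cXY by (simp add: lam_def)
        then have "X = Y" using XY fin[OF Y] by (simp add: card_subset_eq)
        then show False using eq self by blast
      next
        case 2
        then show False using lev \<open>t \<le> d\<close> by (simp add: lam_def)
      next
        case 3
        have XY': "pos X \<subseteq> pos Y" "neg X \<subseteq> neg Y" using XY by (auto simp: pos_def neg_def)
        have finY: "finite (pos Y)" "finite (neg Y)" using sub[OF Y] finite_subset by auto
        have le: "card (pos X) \<le> card (pos Y)" "card (neg X) \<le> card (neg Y)"
          using XY' finY by (simp_all add: card_mono)
        have "c (pos X) \<noteq> c (neg Y)"
        proof (rule proper[rule_format], intro conjI)
          show "pos X \<inter> neg Y = {}" using disj[OF Y] XY' by blast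
          show "t \<le> card (pos X) + card (neg Y)" using card[OF X] le 3 by linarith
        qed (use sub[OF X] sub[OF Y] in auto)
        moreover have "c (pos Y) \<noteq> c (neg X)"
        proof (rule proper[rule_format], intro conjI)
          show "pos Y \<inter> neg X = {}" using disj[OF Y] XY' by blast
          show "t \<le> card (pos Y) + card (neg X)" using card[OF X] le 3 by linarith
        qed (use sub[OF X] sub[OF Y] in auto)
        moreover have "min (c (pos X)) (c (neg X)) = min (c (pos Y)) (c (neg Y))"
          using lev high[of X] high[of Y] 3 cXY by simp
        moreover have "odd (lam X) \<longleftrightarrow> even (lam Y)" by (simp add: eq)
        then have "c (pos X) < c (neg X) \<longleftrightarrow> \<not> c (pos Y) < c (neg Y)"
          using 3 cXY by (simp add: lam_def)
        ultimately show False
          using ne[OF X] ne[OF Y] 3 cXY unfolding min_def by (auto split: if_splits)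
      qed
    qed
  qed
qed

text \<open>Otherwise the labelling above with threshold \<open>d - r\<close> has at most
  \<open>(d - r - 1) + (k - 1) < d\<close> absolute values, against \<open>tucker\<close>.\<close>

lemma kneser_colouring:
  fixes c :: "nat set \<Rightarrow> nat"
  assumes "r < d" "k \<le> Suc r" and c: "\<And>A. A \<subseteq> {..<d} \<Longrightarrow> c A < k"
  obtains A B where "A \<subseteq> {..<d}" "B \<subseteq> {..<d}" "A \<inter> B = {}" "d - r \<le> card A + card B" "c A = c B"
proof (rule ccontr)
  note witness = that
  assume "\<not> thesis"
  then have proper: "\<forall>A B. A \<subseteq> {..<d} \<and> B \<subseteq> {..<d} \<and> A \<inter> B = {} \<and> d - r \<le> card A + card B
      \<longrightarrow> c A \<noteq> c B"
    using witness by metis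
  have td: "d - r \<le> d" by simp
  define pos where "pos = (\<lambda>X :: (nat \<times> bool) set. {i. (i, True) \<in> X})"
  define neg where "neg = (\<lambda>X :: (nat \<times> bool) set. {i. (i, False) \<in> X})"
  define lam where "lam = (\<lambda>X. if card X < d - r then 2 * card X + of_bool ((Min (fst ` X), True) \<in> X)
      else 2 * (d + min (c (pos X)) (c (neg X))) + of_bool (c (pos X) < c (neg X)))"
  note L = octahedral_labelling_colouring[OF td proper pos_def neg_def lam_def]
  interpret octahedral_labelling d lam by (rule L(1))
  have "(\<lambda>X. lam X div 2) ` sign_vectors d \<subseteq> {1..<d - r} \<union> {d..<d + (k - 1)}"
  proof (rule image_subsetI)
    fix X assume X: "X \<in> sign_vectors d"
    then have "X \<noteq> {}" "finite X"
      using finite_sign_vector by (auto simp: sign_vectors_def)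
    then have "card X > 0" by (simp add: card_gt_0_iff)
    \<comment> \<open>The smaller of two different colours below \<open>k\<close> is below
      \<open>k - 1\<close>; this saves the decisive level.\<close>
    moreover have "min (c (pos X)) (c (neg X)) < k - 1" if "\<not> card X < d - r"
      using L(2,3)[OF X] c[of "pos X"] c[of "neg X"] that by (auto simp: min_def)
    ultimately show "lam X div 2 \<in> {1..<d - r} \<union> {d..<d + (k - 1)}"
      by (auto simp: lam_def)
  qed
  then have "card ((\<lambda>X. lam X div 2) ` sign_vectors d) \<le> card ({1..<d - r} \<union> {d..<d + (k - 1)})"
    by (rule card_mono[rotated]) simp
  also have "\<dots> \<le> (d - r - 1) + (k - 1)"
    by (rule order.trans[OF card_Un_le]) simp
  finally show False using tucker assms(1,2) by linarith
qed

section \<open>Sparse digits and forbidden differences\<close>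

text \<open>
  With gaps \<open>i + 6\<close> the numbers in which a carry may reach some digit have density at most \<open>1/4\<close>.
\<close>

primrec expo :: "nat \<Rightarrow> nat" where
  "expo 0 = 0"
| "expo (Suc i) = expo i + i + 6"

definition base :: "nat \<Rightarrow> nat" where
  "base i = 2 ^ expo i"

text \<open>
  The size makes \<open>2 * half_size j choose half_size j\<close> at most
  \<open>4 ^ half_size j / (2 ^ (j + 3) * Suc j)\<close>.
\<close>

definition half_size :: "nat \<Rightarrow> nat" where
  "half_size j = (Suc j)\<^sup>2 * 4 ^ (j + 3)"

definition block_size :: "nat \<Rightarrow> nat" where
  "block_size j = 2 * half_size j"

definition start :: "nat \<Rightarrow> nat" where
  "start j = (\<Sum>l<j. block_size l)"

definition block :: "nat \<Rightarrow> nat set" where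
  "block j = {start j..<start (Suc j)}"

definition last_index :: "nat \<Rightarrow> nat" where
  "last_index k = start (Suc k) - 1"

text \<open>The power of two just above the last base element of block \<open>k\<close>: the numbers
  below \<open>scale k\<close> run through all binary patterns on the positions up to that
  element.\<close>

definition scale :: "nat \<Rightarrow> nat" where
  "scale k = 2 * base (last_index k)"

text \<open>This bounds how far base elements of index below \<open>i\<close>, each used at most
  once, can move a number.\<close>

definition guard :: "nat \<Rightarrow> nat" where
  "guard i = sum base {..<i}"

text \<open>
  Membership is symmetric in \<open>A\<close> and \<open>B\<close>, so these are the absolute values of all such differences.
\<close>

definition forbidden :: "nat set" where
  "forbidden = {m. \<exists>j A B. A \<subseteq> block j \<and> B \<subseteq> block j \<and> A \<inter> B = {}
     \<and> block_size j - j \<le> card A + card B \<and> int m = int (sum base A) - int (sum base B)}"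

section \<open>Growth of the scales and gaps of the forbidden set\<close>

lemma base_Suc: "base (Suc i) = base i * 2 ^ (i + 6)"
  by (simp add: base_def power_add)

lemma base_pos [simp]: "base i > 0"
  by (simp add: base_def)

lemma base_Suc_ge: "64 * base i \<le> base (Suc i)"
proof -
  have "(2::nat) ^ 6 \<le> 2 ^ (i + 6)" by (rule power_increasing) auto
  then show ?thesis by (simp add: base_Suc)
qed

lemma strict_mono_expo: "strict_mono expo"
  by (rule strict_mono_Suc_iff[THEN iffD2]) simp

lemma base_mono: "i \<le> j \<Longrightarrow> base i \<le> base j"
  unfolding base_def using strict_mono_expo by (simp add: strict_mono_less_eq)

lemma base_dvd: "i \<le> j \<Longrightarrow> base i dvd base j"
  unfolding base_def using strict_mono_expo by (simp add: strict_mono_less_eq le_imp_power_dvd)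

lemma two_base_dvd: "i < j \<Longrightarrow> 2 * base i dvd base j"
proof -
  assume "i < j"
  then have "Suc (expo i) \<le> expo j" using strict_mono_expo by (simp add: strict_mono_less Suc_le_eq)
  then have "2 ^ Suc (expo i) dvd (2::nat) ^ expo j" by (rule le_imp_power_dvd)
  then show ?thesis by (simp add: base_def)
qed

lemma guard_bound: "32 * guard i \<le> base i"
proof (induction i)
  case (Suc i)
  have "32 * guard (Suc i) = 32 * guard i + 32 * base i" by (simp add: guard_def)
  with Suc base_Suc_ge[of i] show ?case by linarith
qed (simp add: guard_def)

lemma guard_Suc: "guard (Suc i) = guard i + base i"
  by (simp add: guard_def)

lemma sum_base_le_guard: "A \<subseteq> {..<i} \<Longrightarrow> sum base A \<le> guard i"
  unfolding guard_def by (rule sum_mono2) auto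

lemma base_le_sum_base: "finite A \<Longrightarrow> i \<in> A \<Longrightarrow> base i \<le> sum base A"
  by (rule member_le_sum) auto

lemma block_size_gt: "j < block_size j"
proof -
  have "Suc j * 1 \<le> (Suc j)\<^sup>2 * 4 ^ (j + 3)"
    by (rule mult_le_mono) (auto simp: power2_eq_square)
  then show ?thesis by (simp add: block_size_def half_size_def)
qed

lemma start_Suc: "start (Suc j) = start j + block_size j"
  by (simp add: start_def)

lemma start_mono: "i \<le> j \<Longrightarrow> start i \<le> start j"
  unfolding start_def by (rule sum_mono2) auto

lemma card_block: "card (block j) = block_size j"
  by (simp add: block_def start_Suc)

lemma finite_block [simp]: "finite (block j)"
  by (simp add: block_def)

lemma block_inj: "i \<in> block j \<Longrightarrow> i \<in> block j' \<Longrightarrow> j = j'"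
  using start_mono[of "Suc j" j'] start_mono[of "Suc j'" j]
  by (auto simp: block_def) (meson leD le_less_trans not_less_eq_eq order_trans linorder_cases Suc_leI)

lemma Suc_last_index: "Suc (last_index k) = start (Suc k)"
  using block_size_gt[of k] by (simp add: last_index_def start_Suc)

lemma last_index_ge: "k \<le> last_index k"
  using block_size_gt[of k] by (simp add: last_index_def start_Suc)

lemma block_subset: "j \<le> k \<Longrightarrow> block j \<subseteq> {..last_index k}"
  using start_mono[of "Suc j" "Suc k"] Suc_last_index[of k] by (auto simp: block_def)

lemma strict_mono_last_index: "strict_mono last_index"
proof (rule strict_mono_Suc_iff[THEN iffD2], rule allI)
  fix k show "last_index k < last_index (Suc k)"
    using block_size_gt[of "Suc k"] start_Suc[of "Suc k"] Suc_last_index[of k] Suc_last_index[of "Suc k"] by simp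
qed

lemma scale_growth: "k < l \<Longrightarrow> 2 ^ (k + 6) * scale k \<le> scale l"
proof -
  assume "k < l"
  then have "Suc (last_index k) \<le> last_index l"
    using strict_mono_last_index by (simp add: strict_mono_less Suc_le_eq)
  then have "base (last_index k) * 2 ^ (last_index k + 6) \<le> base (last_index l)"
    using base_mono base_Suc by metis
  moreover have "(2::nat) ^ (k + 6) \<le> 2 ^ (last_index k + 6)"
    using last_index_ge by simp
  then have "base (last_index k) * 2 ^ (k + 6) \<le> base (last_index k) * 2 ^ (last_index k + 6)"
    by simp
  ultimately have "base (last_index k) * 2 ^ (k + 6) \<le> base (last_index l)" by (rule order.trans[rotated])
  then show ?thesis by (simp add: scale_def ac_simps)
qed

lemma scale_pos [simp]: "scale k > 0"
  by (simp add: scale_def)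

lemma scale_ge: "k < scale k"
proof -
  have "i < 2 ^ expo i" for i
    by (rule le_less_trans[of _ "expo i"]) (simp_all add: strict_mono_imp_increasing[OF strict_mono_expo] less_exp)
  from this[of "last_index k"] show ?thesis
    using last_index_ge[of k] by (simp add: scale_def base_def)
qed

lemma scale_mono: "k \<le> l \<Longrightarrow> scale k \<le> scale l"
  unfolding scale_def using base_mono strict_mono_last_index by (simp add: strict_mono_less_eq)

text \<open>Blocks up to \<open>k\<close> contribute too little to reach \<open>scale k\<close>. In
  a later block the largest index used dominates all others by sparseness, and its base element is
  already far above \<open>scale k\<close>.\<close>

lemma forbidden_cases:
  assumes "A \<subseteq> block j" "B \<subseteq> block j" "A \<inter> B = {}" "block_size j - j \<le> card A + card B"
    and m: "int m = int (sum base A) - int (sum base B)"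
  shows "if j \<le> k then m < scale k else 3 * scale k < m"
proof (cases "j \<le> k")
  case True
  have "m \<le> sum base A" using m by linarith
  also have "\<dots> \<le> guard (Suc (last_index k))"
    using assms(1) block_subset[OF True] by (intro sum_base_le_guard) auto
  also have "\<dots> < scale k"
    unfolding guard_Suc scale_def
    using guard_bound[of "last_index k"] base_pos[of "last_index k"] by linarith
  finally show ?thesis using True by simp
next
  case False
  have fin: "finite A" "finite B" using assms(1,2) finite_subset[OF _ finite_block] by blast+
  let ?i = "Max (A \<union> B)"
  have "A \<union> B \<noteq> {}" using assms(4) block_size_gt[of j] by auto
  then have i: "?i \<in> A \<union> B" using fin by (intro Max_in) auto
  have le: "A \<subseteq> {..?i}" "B \<subseteq> {..?i}" using fin by auto
  have "start (Suc k) \<le> ?i"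
    using i assms(1,2) start_mono[of "Suc k" j] False by (auto simp: block_def)
  then have "base (Suc (last_index k)) \<le> base ?i" using base_mono Suc_last_index by simp
  then have big: "32 * scale k \<le> base ?i" using base_Suc_ge[of "last_index k"] by (simp add: scale_def)
  \<comment> \<open>In \<open>B\<close> the largest base element would outweigh all of
    \<open>A\<close> and make the difference negative.\<close>
  have "?i \<notin> B"
  proof
    assume "?i \<in> B"
    then have "A \<subseteq> {..<?i}" using le assms(3) by (force simp: less_le)
    then have "sum base A \<le> guard ?i" by (rule sum_base_le_guard)
    moreover have "base ?i \<le> sum base B" using \<open>?i \<in> B\<close> fin base_le_sum_base by blast
    ultimately show False using m guard_bound[of ?i] base_pos[of ?i] by linarith
  qed
  then have "?i \<in> A" using i by blast
  then have "base ?i \<le> sum base A" using fin base_le_sum_base by blast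
  moreover have "B \<subseteq> {..<?i}" using le \<open>?i \<notin> B\<close> by (force simp: less_le)
  then have "sum base B \<le> guard ?i" by (rule sum_base_le_guard)
  ultimately have "3 * scale k < m" using m guard_bound[of ?i] big scale_pos[of k] by linarith
  then show ?thesis using False by simp
qed

lemma forbidden_gap: "scale k \<le> m \<Longrightarrow> m \<le> 3 * scale k \<Longrightarrow> m \<notin> forbidden"
  unfolding forbidden_def using forbidden_cases[of _ _ _ m k]
  by (auto split: if_splits) (metis linorder_not_less)

section \<open>Digits under changes without carries\<close>

lemma sum_base_split:
  assumes "finite A"
  obtains a t where "sum base A = a + of_bool (i \<in> A) * base i + 2 * base i * t" "a \<le> guard i"
proof -
  have "A = (A \<inter> {..<i}) \<union> ((A \<inter> {i}) \<union> (A \<inter> {i<..}))" by auto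
  then have "sum base A = sum base ((A \<inter> {..<i}) \<union> ((A \<inter> {i}) \<union> (A \<inter> {i<..})))" by simp
  also have "\<dots> = sum base (A \<inter> {..<i}) + (sum base (A \<inter> {i}) + sum base (A \<inter> {i<..}))"
    using assms by (subst sum.union_disjoint; auto)+
  also have "sum base (A \<inter> {i}) = of_bool (i \<in> A) * base i" by (cases "i \<in> A") auto
  finally have eq: "sum base A = sum base (A \<inter> {..<i}) + of_bool (i \<in> A) * base i + sum base (A \<inter> {i<..})"
    by simp
  have "2 * base i dvd sum base (A \<inter> {i<..})" by (rule dvd_sum) (simp add: two_base_dvd)
  then obtain t where "sum base (A \<inter> {i<..}) = 2 * base i * t" by (rule dvdE)
  with eq show thesis using that[of "sum base (A \<inter> {..<i})" t] sum_base_le_guard by simp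
qed

text \<open>
  A guarded number can be changed by any combination of lower base elements without a carry
  reaching digit \<open>i\<close>.
\<close>

definition guarded :: "nat \<Rightarrow> nat \<Rightarrow> bool" where
  "guarded i n \<longleftrightarrow> guard i \<le> n mod base i \<and> n mod base i + guard i < base i"

definition digit :: "nat \<Rightarrow> nat \<Rightarrow> bool" where
  "digit i n \<longleftrightarrow> odd (n div base i)"

text \<open>Guardedness keeps the remainder modulo \<open>base i\<close> within its range, so the
  quotient changes only by the contribution of \<open>i\<close> itself and by an even
  number.\<close>

lemma digit_flip:
  assumes "guarded i n" "finite A" "finite B" "A \<inter> B = {}"
    and m: "int m = int n + int (sum base A) - int (sum base B)"
  shows "digit i m \<longleftrightarrow> (digit i n \<noteq> (i \<in> A \<union> B))"
proof -
  obtain a s where a: "sum base A = a + of_bool (i \<in> A) * base i + 2 * base i * s" "a \<le> guard i"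
    using sum_base_split[OF assms(2)] .
  obtain b t where b: "sum base B = b + of_bool (i \<in> B) * base i + 2 * base i * t" "b \<le> guard i"
    using sum_base_split[OF assms(3)] .
  let ?q = "int (base i)"
  let ?r = "int (n mod base i) + int a - int b"
  let ?d = "int (n div base i) + of_bool (i \<in> A) - of_bool (i \<in> B) + 2 * (int s - int t)"
  have "int n = ?q * int (n div base i) + int (n mod base i)"
    by (metis mult_div_mod_eq of_nat_add of_nat_mult)
  then have "int m = ?q * ?d + ?r"
    unfolding m a(1) b(1) by (simp add: algebra_simps)
  moreover have "0 \<le> ?r" "?r < ?q" using assms(1) a(2) b(2) by (auto simp: guarded_def)
  ultimately have "int m div ?q = ?d" by (rule int_div_pos_eq)
  then have "int (m div base i) = ?d" by (simp add: zdiv_int)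
  then have "even (m div base i) \<longleftrightarrow> even ?d" by (metis even_of_nat)
  then show ?thesis using assms(4) by (auto simp: digit_def)
qed

definition weight :: "nat \<Rightarrow> nat \<Rightarrow> nat" where
  "weight j n = card {i \<in> block j. digit i n}"

text \<open>The weights close to one half, where flipping all but \<open>j\<close> digits of the
  block need not reverse the majority. They are excluded from \<open>good\<close>.\<close>

definition balanced :: "nat \<Rightarrow> nat \<Rightarrow> bool" where
  "balanced j n \<longleftrightarrow> block_size j \<le> 2 * weight j n + j \<and> 2 * weight j n \<le> block_size j + j"

definition good :: "nat \<Rightarrow> nat set" where
  "good k = {n. n < scale k \<and> (\<forall>i\<le>last_index k. guarded i n) \<and> (\<forall>j\<le>k. \<not> balanced j n)}"

definition majority_parity :: "nat \<Rightarrow> nat \<Rightarrow> bool" where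
  "majority_parity k n \<longleftrightarrow> odd (card {j. j \<le> k \<and> block_size j < 2 * weight j n})"

lemma weight_flip:
  assumes "A \<subseteq> block j" "B \<subseteq> block j" "A \<inter> B = {}" "block_size j - j \<le> card A + card B"
    and m: "int m = int n + int (sum base A) - int (sum base B)"
    and guarded: "\<And>i. i \<in> block j \<Longrightarrow> guarded i n"
    and nb: "\<not> balanced j n" "\<not> balanced j m"
  shows "block_size j < 2 * weight j m \<longleftrightarrow> \<not> block_size j < 2 * weight j n"
proof -
  have fin: "finite A" "finite B" using assms(1,2) finite_subset[OF _ finite_block] by blast+
  let ?x = "{i \<in> block j. digit i n}" and ?D = "A \<union> B"
  have xm: "{i \<in> block j. digit i m} = (?x - ?D) \<union> (?D - ?x)"
    using digit_flip[OF guarded fin assms(3) m] assms(1,2) by auto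
  have "card {i \<in> block j. digit i m} = card (?x - ?D) + card (?D - ?x)"
    unfolding xm using fin by (intro card_Un_disjoint) auto
  moreover have "card ?x = card (?x - ?D) + card (?x \<inter> ?D)"
    by (subst card_Un_disjoint[symmetric]) (auto intro!: arg_cong[where f = card])
  moreover have "card ?D = card (?D - ?x) + card (?x \<inter> ?D)"
    using fin by (subst card_Un_disjoint[symmetric]) (auto intro!: arg_cong[where f = card])
  moreover have "card ((?x - ?D) \<union> ?D) \<le> card (block j)"
    using assms(1,2) by (intro card_mono) auto
  then have "card (?x - ?D) + card ?D \<le> block_size j"
    using fin by (subst (asm) card_Un_disjoint) (auto simp: card_block)
  moreover have "card ?D = card A + card B" using assms(3) fin by (simp add: card_Un_disjoint)
  \<comment> \<open>With \<open>x\<close> the old digit set and \<open>D\<close> the flipped one,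
    the two weights add up to \<open>card D + 2 * card (x - D)\<close>, and \<open>D\<close> omits
    at most \<open>j\<close> positions of the block.\<close>
  ultimately have "block_size j \<le> weight j m + weight j n + j"
    and "weight j m + weight j n \<le> block_size j + j"
    using assms(4) by (auto simp: weight_def)
  then show ?thesis using nb by (auto simp: balanced_def)
qed

lemma weight_other:
  assumes "A \<subseteq> block j" "B \<subseteq> block j" "A \<inter> B = {}" "j' \<noteq> j"
    and m: "int m = int n + int (sum base A) - int (sum base B)"
    and guarded: "\<And>i. i \<in> block j' \<Longrightarrow> guarded i n"
  shows "weight j' m = weight j' n"
proof -
  have fin: "finite A" "finite B" using assms(1,2) finite_subset[OF _ finite_block] by blast+
  have "digit i m \<longleftrightarrow> digit i n" if "i \<in> block j'" for i
  proof -
    have "i \<notin> A \<union> B" using that assms(1,2,4) block_inj by blast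
    then show ?thesis using digit_flip[OF guarded[OF that] fin assms(3) m] by blast
  qed
  then show ?thesis unfolding weight_def by (metis (mono_tags, lifting) Collect_cong)
qed

text \<open>A forbidden difference belongs to a single block: it reverses the majority there and
  leaves every other block up to \<open>k\<close> unchanged.\<close>

lemma majority_parity_flip:
  assumes n: "n \<in> good k" and m: "m \<in> good k" and "n < m" and f: "m - n \<in> forbidden"
  shows "majority_parity k m \<noteq> majority_parity k n"
proof -
  obtain j A B where AB: "A \<subseteq> block j" "B \<subseteq> block j" "A \<inter> B = {}"
      "block_size j - j \<le> card A + card B" "int (m - n) = int (sum base A) - int (sum base B)"
    using f unfolding forbidden_def by blast
  have eq: "int m = int n + int (sum base A) - int (sum base B)" using AB(5) \<open>n < m\<close> by linarith
  \<comment> \<open>Both numbers are below \<open>scale k\<close>, whereas differences from later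
    blocks exceed \<open>3 * scale k\<close>.\<close>
  have jk: "j \<le> k"
    using forbidden_cases[OF AB, of k] m by (auto simp: good_def split: if_splits)
  have g: "guarded i n" if "i \<in> block j'" "j' \<le> k" for i j'
    using n block_subset[OF that(2)] that(1) by (auto simp: good_def)
  let ?S = "\<lambda>n. {j. j \<le> k \<and> block_size j < 2 * weight j n}"
  have fl: "j \<in> ?S m \<longleftrightarrow> j \<notin> ?S n"
    using weight_flip[OF AB(1-4) eq g[OF _ jk]] n m jk by (auto simp: good_def)
  have "weight j' m = weight j' n" if "j' \<le> k" "j' \<noteq> j" for j'
    using weight_other[OF AB(1-3) that(2) eq g[OF _ that(1)]] .
  then have ot: "?S m - {j} = ?S n - {j}" by auto
  have fin: "finite (?S n)" for n by simp
  show ?thesis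
  proof (cases "j \<in> ?S n")
    case True
    then have "?S m = ?S n - {j}" using fl ot by blast
    then have "card (?S n) = Suc (card (?S m))" using card.remove[OF fin True] by simp
    then show ?thesis by (simp add: majority_parity_def)
  next
    case False
    then have "?S n = ?S m - {j}" "j \<in> ?S m" using fl ot by blast+
    then have "card (?S m) = Suc (card (?S n))" using card.remove[OF fin, of j m] by simp
    then show ?thesis by (simp add: majority_parity_def)
  qed
qed

text \<open>
  The larger of the two classes of \<open>good k\<close> with respect to \<open>majority_parity k\<close> is a possible value.
\<close>

definition separated :: "nat \<Rightarrow> nat set" where
  "separated k = (SOME S. S \<subseteq> good k \<and> card (good k) \<le> 2 * card S
     \<and> (\<forall>n\<in>S. \<forall>m\<in>S. n < m \<longrightarrow> m - n \<notin> forbidden))"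

lemma separated:
  "separated k \<subseteq> good k" "card (good k) \<le> 2 * card (separated k)"
  "n \<in> separated k \<Longrightarrow> m \<in> separated k \<Longrightarrow> n < m \<Longrightarrow> m - n \<notin> forbidden"
proof -
  let ?P = "\<lambda>S. S \<subseteq> good k \<and> card (good k) \<le> 2 * card S
     \<and> (\<forall>n\<in>S. \<forall>m\<in>S. n < m \<longrightarrow> m - n \<notin> forbidden)"
  let ?T = "\<lambda>b. {n \<in> good k. majority_parity k n = b}"
  have fin: "finite (good k)" by (rule finite_subset[of _ "{..<scale k}"]) (auto simp: good_def)
  have "good k = ?T True \<union> ?T False" by auto
  then have "card (good k) \<le> card (?T True) + card (?T False)" by (metis card_Un_le)
  then have "card (good k) \<le> 2 * card (?T True) \<or> card (good k) \<le> 2 * card (?T False)" by linarith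
  then obtain b where "card (good k) \<le> 2 * card (?T b)" by blast
  then have "?P (?T b)" using majority_parity_flip by blast
  then have "?P (separated k)" unfolding separated_def by (rule someI)
  then show "separated k \<subseteq> good k" "card (good k) \<le> 2 * card (separated k)"
    "n \<in> separated k \<Longrightarrow> m \<in> separated k \<Longrightarrow> n < m \<Longrightarrow> m - n \<notin> forbidden" by blast+
qed

section \<open>Density of the good numbers\<close>

lemma card_mod_in:
  fixes a b :: nat
  assumes "R \<subseteq> {..<b}"
  shows "card {n. n < a * b \<and> n mod b \<in> R} \<le> a * card R"
proof -
  let ?S = "{n. n < a * b \<and> n mod b \<in> R}"
  have "inj_on (\<lambda>n. (n div b, n mod b)) ?S" by (rule inj_onI) (metis Pair_inject div_mod_decomp)
  moreover have "(\<lambda>n. (n div b, n mod b)) ` ?S \<subseteq> {..<a} \<times> R"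
    by (auto simp: less_mult_imp_div_less)
  moreover have "finite R" using assms finite_subset by blast
  then have "finite ({..<a} \<times> R)" by simp
  ultimately have "card ?S \<le> card ({..<a} \<times> R)" by (rule card_inj_on_le)
  then show ?thesis by (simp add: card_cartesian_product)
qed

text \<open>Unguarded residues modulo \<open>base i\<close> number at most
  \<open>2 * guard i\<close>. For \<open>i > 0\<close>, \<open>guard i\<close> is at most twice the
  preceding base element, and the growing exponent gaps supply the factor
  \<open>2 ^ (i + 3)\<close>.\<close>

lemma card_not_guarded:
  assumes "i \<le> last_index k"
  shows "2 ^ (i + 3) * card {n. n < scale k \<and> \<not> guarded i n} \<le> scale k"
proof -
  have "base i dvd scale k" using base_dvd[OF assms] by (simp add: scale_def)
  then obtain a where a: "scale k = a * base i" by (metis dvdE mult.commute)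
  let ?R = "{..<guard i} \<union> {base i - guard i..<base i}"
  have "{n. n < scale k \<and> \<not> guarded i n} \<subseteq> {n. n < a * base i \<and> n mod base i \<in> ?R}"
    unfolding a guarded_def by (auto simp: not_le not_less)
  then have "card {n. n < scale k \<and> \<not> guarded i n} \<le> card {n. n < a * base i \<and> n mod base i \<in> ?R}"
    by (intro card_mono) auto
  also have "\<dots> \<le> a * card ?R"
    using guard_bound[of i] by (intro card_mod_in) auto
  also have "card ?R \<le> 2 * guard i" by (rule order.trans[OF card_Un_le]) simp
  then have "a * card ?R \<le> a * (2 * guard i)" by simp
  finally have "2 ^ (i + 3) * card {n. n < scale k \<and> \<not> guarded i n} \<le> 2 ^ (i + 3) * (a * (2 * guard i))"
    by simp
  also have "\<dots> = a * (2 ^ (i + 4) * guard i)" by (simp add: power_add)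
  also have "2 ^ (i + 4) * guard i \<le> base i"
  proof (cases i)
    case (Suc l)
    have "guard i \<le> 2 * base l" using guard_bound[of l] by (simp add: Suc guard_Suc)
    then have "2 ^ (i + 4) * guard i \<le> 2 ^ (i + 4) * (2 * base l)" by simp
    also have "\<dots> = base i" by (simp add: Suc base_Suc power_add)
    finally show ?thesis .
  qed (simp add: guard_def)
  then have "a * (2 ^ (i + 4) * guard i) \<le> scale k" unfolding a by simp
  finally show ?thesis .
qed

text \<open>The left side grows by the factor
  \<open>4 * (2 * h + 1) * (2 * h + 3) / (Suc h)^2\<close>, which is at most 16.\<close>

lemma central_binomial_upper: "((2 * h) choose h)\<^sup>2 * (2 * h + 1) \<le> 16 ^ h"
proof (induction h)
  case (Suc h)
  let ?c = "(2 * h) choose h" and ?d = "(2 * Suc h) choose Suc h"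
  have "Suc h * ?d = 2 * (2 * h + 1) * ?c"
  proof -
    have 1: "Suc h * ((2 * Suc h) choose Suc h) = 2 * Suc h * (Suc (2 * h) choose h)"
      using Suc_times_binomial_eq[of "Suc (2 * h)" h] by simp
    have 2: "Suc h * (Suc (2 * h) choose h) = Suc (2 * h) * ?c"
      using binomial_absorb_comp[of "Suc (2 * h)" h] by simp
    have "Suc h * ?d = 2 * (Suc h * (Suc (2 * h) choose h))" using 1 by (simp only: mult.assoc)
    also have "\<dots> = 2 * (2 * h + 1) * ?c" unfolding 2 by simp
    finally show ?thesis .
  qed
  moreover have "(Suc h)\<^sup>2 * (?d\<^sup>2 * (2 * Suc h + 1)) = (Suc h * ?d)\<^sup>2 * (2 * h + 3)"
  proof -
    have "2 * Suc h + 1 = 2 * h + 3" by simp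
    then show ?thesis by (simp only: power_mult_distrib mult.assoc)
  qed
  moreover have "(2 * a * c)\<^sup>2 * b = 4 * a * b * (c\<^sup>2 * a)" for a b c :: nat
    by (simp add: power2_eq_square)
  ultimately have "(Suc h)\<^sup>2 * (?d\<^sup>2 * (2 * Suc h + 1)) = 4 * (2 * h + 1) * (2 * h + 3) * (?c\<^sup>2 * (2 * h + 1))"
    by metis
  also have "\<dots> \<le> 4 * (2 * h + 1) * (2 * h + 3) * 16 ^ h"
    using Suc by (rule mult_le_mono2)
  also have "4 * (2 * h + 1) * (2 * h + 3) \<le> (Suc h)\<^sup>2 * 16"
    by (simp add: power2_eq_square algebra_simps)
  then have "4 * (2 * h + 1) * (2 * h + 3) * 16 ^ h \<le> (Suc h)\<^sup>2 * 16 ^ Suc h"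
    by (simp add: mult.assoc[symmetric] del: mult_Suc mult_Suc_right)
  finally show ?case by simp
qed simp

text \<open>\<open>half_size j\<close> is the square of \<open>2 ^ (j + 3) * Suc j\<close>, so this
  is the square root of the preceding bound.\<close>

lemma central_binomial_half_size:
  "2 ^ (j + 3) * (Suc j * (block_size j choose half_size j)) \<le> 2 ^ block_size j"
proof -
  let ?h = "half_size j"
  let ?c = "block_size j choose ?h"
  have "(2 ^ n)\<^sup>2 = (4::nat) ^ n" for n
    by (simp add: power2_eq_square power_mult_distrib[symmetric])
  note sq = this
  then have "(2 ^ (j + 3) * (Suc j * c))\<^sup>2 = ?h * c\<^sup>2" for c :: nat
    unfolding half_size_def power_mult_distrib by (simp only: ac_simps)
  then have "(2 ^ (j + 3) * (Suc j * ?c))\<^sup>2 = ?h * ?c\<^sup>2" .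
  also have "\<dots> \<le> ?c\<^sup>2 * (2 * ?h + 1)" by simp
  also have "\<dots> \<le> 16 ^ ?h" using central_binomial_upper[of ?h] by (simp add: block_size_def)
  also have "\<dots> = (2 ^ block_size j)\<^sup>2" unfolding block_size_def sq by (simp add: power_mult)
  finally show ?thesis by (simp only: power2_nat_le_eq_le)
qed


lemma set_decode_subset: "n < 2 ^ K \<Longrightarrow> set_decode n \<subseteq> {..<K}"
proof
  fix i assume n: "n < 2 ^ K" and "i \<in> set_decode n"
  then have "n div 2 ^ i \<noteq> 0" by (auto simp: set_decode_def intro: Nat.gr0I)
  then have "(2::nat) ^ i \<le> n" by (meson div_less not_le)
  then have "(2::nat) ^ i < 2 ^ K" using n by (rule le_less_trans)
  then show "i \<in> {..<K}" by simp
qed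

lemma card_inter_card_in:
  assumes "J \<subseteq> {..<K}" "finite W"
  shows "card {S. S \<subseteq> {..<K} \<and> card (S \<inter> J) \<in> W} \<le> (\<Sum>w\<in>W. card J choose w) * 2 ^ (K - card J)"
proof -
  have fJ: "finite J" using assms(1) finite_subset by blast
  let ?A = "{S. S \<subseteq> {..<K} \<and> card (S \<inter> J) \<in> W}"
  let ?B = "(\<Union>w\<in>W. {T. T \<subseteq> J \<and> card T = w}) \<times> Pow ({..<K} - J)"
  have "inj_on (\<lambda>S. (S \<inter> J, S - J)) ?A" by (rule inj_onI) blast
  moreover have "(\<lambda>S. (S \<inter> J, S - J)) ` ?A \<subseteq> ?B" by auto
  moreover have "finite ?B" using fJ assms(2) by auto
  ultimately have "card ?A \<le> card ?B" by (rule card_inj_on_le)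
  also have "\<dots> = card (\<Union>w\<in>W. {T. T \<subseteq> J \<and> card T = w}) * 2 ^ (K - card J)"
    using assms(1) fJ by (simp add: card_cartesian_product card_Pow card_Diff_subset)
  also have "card (\<Union>w\<in>W. {T. T \<subseteq> J \<and> card T = w}) \<le> (\<Sum>w\<in>W. card {T. T \<subseteq> J \<and> card T = w})"
    using assms(2) by (rule card_UN_le)
  also have "\<dots> = (\<Sum>w\<in>W. card J choose w)" by (simp add: n_subsets fJ)
  finally show ?thesis by simp
qed

text \<open>Numbers below \<open>scale k\<close> correspond to sets of binary positions. At most
  \<open>Suc j\<close> weights are balanced, and each has at most a central binomial coefficient of
  patterns on the block.\<close>

lemma card_balanced:
  assumes "j \<le> k"
  shows "2 ^ (j + 3) * card {n. n < scale k \<and> balanced j n} \<le> scale k"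
proof -
  define K where "K = Suc (expo (last_index k))"
  have scale: "scale k = 2 ^ K" by (simp add: K_def scale_def base_def)
  define J where "J = expo ` block j"
  have inj: "inj expo" using strict_mono_expo by (rule strict_mono_imp_inj_on)
  have JK: "J \<subseteq> {..<K}"
    using block_subset[OF assms] strict_mono_expo by (auto simp: J_def K_def less_Suc_eq_le strict_mono_less_eq)
  have cJ: "card J = block_size j" unfolding J_def using inj by (simp add: card_image inj_on_subset card_block)
  have weight: "weight j n = card (set_decode n \<inter> J)" for n
  proof -
    have "set_decode n \<inter> J = expo ` {i \<in> block j. digit i n}"
      by (auto simp: J_def digit_def base_def set_decode_def)
    then show ?thesis unfolding weight_def using inj by (simp add: card_image inj_on_subset)
  qed
  let ?W = "{w. block_size j \<le> 2 * w + j \<and> 2 * w \<le> block_size j + j}"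
  have Wsub: "?W \<subseteq> {half_size j - j div 2..half_size j + j div 2}"
    by (auto simp: block_size_def)
  then have fW: "finite ?W" by (rule finite_subset) simp
  have "card ?W \<le> card {half_size j - j div 2..half_size j + j div 2}" using Wsub by (rule card_mono[rotated]) simp
  also have "\<dots> \<le> Suc j" by simp
  finally have cW: "card ?W \<le> Suc j" .
  have "inj_on set_decode {n. n < scale k \<and> balanced j n}"
    by (rule inj_on_inverseI[where g = set_encode]) simp
  moreover have "set_decode ` {n. n < scale k \<and> balanced j n} \<subseteq> {S. S \<subseteq> {..<K} \<and> card (S \<inter> J) \<in> ?W}"
    using set_decode_subset by (auto simp: scale balanced_def weight)
  moreover have "finite {S. S \<subseteq> {..<K} \<and> card (S \<inter> J) \<in> ?W}"
    by (rule finite_subset[of _ "Pow {..<K}"]) auto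
  ultimately have "card {n. n < scale k \<and> balanced j n} \<le> card {S. S \<subseteq> {..<K} \<and> card (S \<inter> J) \<in> ?W}"
    by (rule card_inj_on_le)
  also have "\<dots> \<le> (\<Sum>w\<in>?W. block_size j choose w) * 2 ^ (K - block_size j)"
    using card_inter_card_in[OF JK fW] by (simp only: cJ)
  also have "(\<Sum>w\<in>?W. block_size j choose w) \<le> card ?W * (block_size j choose half_size j)"
  proof -
    have "block_size j choose w \<le> block_size j choose half_size j" for w
      using binomial_maximum[of "block_size j" w] by (simp add: block_size_def)
    then show ?thesis
      using sum_bounded_above[of ?W "\<lambda>w. block_size j choose w" "block_size j choose half_size j"] by simp
  qed
  also have "\<dots> \<le> Suc j * (block_size j choose half_size j)" using cW by (rule mult_le_mono1)
  finally have "2 ^ (j + 3) * card {n. n < scale k \<and> balanced j n}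
      \<le> 2 ^ (j + 3) * (Suc j * (block_size j choose half_size j) * 2 ^ (K - block_size j))"
    by simp
  also have "\<dots> = 2 ^ (j + 3) * (Suc j * (block_size j choose half_size j)) * 2 ^ (K - block_size j)"
    by (simp only: mult.assoc)
  also have "\<dots> \<le> 2 ^ block_size j * 2 ^ (K - block_size j)"
    using central_binomial_half_size by (rule mult_le_mono1)
  also have "\<dots> = scale k"
  proof -
    have "block_size j \<le> K" using cJ JK card_mono[of "{..<K}" J] by simp
    then show ?thesis by (simp add: scale power_add[symmetric])
  qed
  finally show ?thesis .
qed

lemma sum_weighted_le:
  fixes f :: "nat \<Rightarrow> nat"
  assumes "\<And>i. i < m \<Longrightarrow> 2 ^ (i + 3) * f i \<le> N"
  shows "4 * sum f {..<m} \<le> N"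
proof -
  \<comment> \<open>The extra \<open>N\<close> is the remaining tail of the geometric series;
    without it the induction would not close.\<close>
  have *: "2 ^ m * (4 * sum f {..<m}) + N \<le> 2 ^ m * N"
    using assms
  proof (induction m)
    case (Suc m)
    have "2 ^ m * (4 * sum f {..<m}) + N \<le> 2 ^ m * N" using Suc by simp
    moreover have "2 ^ (m + 3) * f m \<le> N" using Suc.prems by simp
    ultimately show ?case by (simp add: power_add algebra_simps)
  qed simp
  then have "2 ^ m * (4 * sum f {..<m}) \<le> 2 ^ m * N" by linarith
  then show ?thesis by simp
qed

text \<open>Unguarded numbers and numbers with a balanced block each make up at most a
  quarter.\<close>

lemma card_good: "scale k \<le> 2 * card (good k)"
proof -
  let ?G = "\<lambda>i. {n. n < scale k \<and> \<not> guarded i n}" and ?W = "\<lambda>j. {n. n < scale k \<and> balanced j n}"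
  have "{..<scale k} \<subseteq> good k \<union> ((\<Union>i<Suc (last_index k). ?G i) \<union> (\<Union>j<Suc k. ?W j))"
    by (auto simp: good_def less_Suc_eq_le)
  then have "card {..<scale k} \<le> card (good k \<union> ((\<Union>i<Suc (last_index k). ?G i) \<union> (\<Union>j<Suc k. ?W j)))"
    by (rule card_mono[rotated]) (auto simp: good_def)
  also have "\<dots> \<le> card (good k) + card ((\<Union>i<Suc (last_index k). ?G i) \<union> (\<Union>j<Suc k. ?W j))"
    by (rule card_Un_le)
  also have "card ((\<Union>i<Suc (last_index k). ?G i) \<union> (\<Union>j<Suc k. ?W j))
      \<le> card (\<Union>i<Suc (last_index k). ?G i) + card (\<Union>j<Suc k. ?W j)"
    by (rule card_Un_le)
  also have "card (\<Union>i<Suc (last_index k). ?G i) \<le> (\<Sum>i<Suc (last_index k). card (?G i))"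
    by (rule card_UN_le) simp
  also have "card (\<Union>j<Suc k. ?W j) \<le> (\<Sum>j<Suc k. card (?W j))"
    by (rule card_UN_le) simp
  finally have "scale k \<le> card (good k) + ((\<Sum>i<Suc (last_index k). card (?G i)) + (\<Sum>j<Suc k. card (?W j)))"
    by simp
  moreover have "4 * (\<Sum>i<Suc (last_index k). card (?G i)) \<le> scale k"
    by (rule sum_weighted_le) (simp add: card_not_guarded)
  moreover have "4 * (\<Sum>j<Suc k. card (?W j)) \<le> scale k"
    by (rule sum_weighted_le) (simp add: card_balanced)
  ultimately show ?thesis by linarith
qed

lemma card_separated: "scale k \<le> 4 * card (separated k)"
  using card_good[of k] separated(2)[of k] by linarith

section \<open>Proximality\<close>

lemma sum_base_inj:
  assumes "finite A" "finite B" "sum base A = sum base B"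
  shows "A = B"
proof -
  have inj: "inj expo" using strict_mono_expo by (rule strict_mono_imp_inj_on)
  have "sum base S = set_encode (expo ` S)" for S
    unfolding set_encode_def base_def using inj by (simp add: sum.reindex inj_on_subset)
  then have "expo ` A = expo ` B" using assms by (simp add: set_encode_eq)
  then show ?thesis using inj by (simp add: inj_image_eq_iff)
qed

text \<open>The pair of the full block and the empty set is one of those defining
  \<open>forbidden\<close>, so \<open>forbidden_cases\<close> bounds the sum over the whole
  block.\<close>

lemma sum_base_block_less: "A \<subseteq> block j \<Longrightarrow> sum base A < scale j"
  using forbidden_cases[of "block j" j "{}" "sum base (block j)" j] sum_mono2[of "block j" A base]
  by (auto simp: card_block intro: le_less_trans)

text \<open>A subset of block \<open>j\<close> receives the colour of \<open>b\<close> plus its sum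
  of base elements; the Kneser statement for \<open>Suc j\<close> colours then yields two disjoint
  sets whose difference is forbidden.\<close>

lemma forbidden_monochromatic:
  fixes col :: "nat \<Rightarrow> nat"
  assumes "\<And>n. col n \<le> j"
  obtains n m where "b \<le> n" "n < m" "m < b + scale j" "m - n \<in> forbidden" "col n = col m"
proof -
  define emb where "emb A = (+) (start j) ` A" for A
  have emb: "emb A \<subseteq> block j" if "A \<subseteq> {..<block_size j}" for A
    using that by (auto simp: emb_def block_def start_Suc)
  have card_emb: "card (emb A) = card A" for A
    unfolding emb_def by (rule card_image) simp
  obtain A B where AB: "A \<subseteq> {..<block_size j}" "B \<subseteq> {..<block_size j}" "A \<inter> B = {}"
      "block_size j - j \<le> card A + card B" "col (b + sum base (emb A)) = col (b + sum base (emb B))"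
    by (rule kneser_colouring[of j "block_size j" "Suc j" "\<lambda>A. col (b + sum base (emb A))"])
       (use assms block_size_gt in \<open>auto simp: less_Suc_eq_le\<close>)
  have disj: "emb A \<inter> emb B = {}" using AB(3) by (auto simp: emb_def)
  have forb: "m \<in> forbidden" if "int m = int (sum base (emb A)) - int (sum base (emb B))" for m
    unfolding forbidden_def
    using emb[OF AB(1)] emb[OF AB(2)] disj AB(4) that
    by (intro CollectI exI[of _ j] exI[of _ "emb A"] exI[of _ "emb B"]) (simp only: card_emb simp_thms)
  have forb': "m \<in> forbidden" if "int m = int (sum base (emb B)) - int (sum base (emb A))" for m
    unfolding forbidden_def
    using emb[OF AB(1)] emb[OF AB(2)] disj AB(4) that
    by (intro CollectI exI[of _ j] exI[of _ "emb B"] exI[of _ "emb A"])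
       (simp only: card_emb simp_thms Int_commute add.commute)
  \<comment> \<open>Equal sums would force two disjoint sets to coincide and thus to be empty, but
    together they omit at most \<open>j\<close> of more than \<open>j\<close> positions.\<close>
  have "sum base (emb A) \<noteq> sum base (emb B)"
  proof
    assume "sum base (emb A) = sum base (emb B)"
    moreover have "finite (emb A)" "finite (emb B)"
      using emb[OF AB(1)] emb[OF AB(2)] finite_subset[OF _ finite_block] by blast+
    ultimately have "emb A = emb B" using sum_base_inj by blast
    then have "emb A = {}" "emb B = {}" using disj by auto
    then show False using AB(4) card_emb[of A] card_emb[of B] block_size_gt[of j] by simp
  qed
  then consider "sum base (emb A) < sum base (emb B)" | "sum base (emb B) < sum base (emb A)" by linarith
  then show thesis
  proof cases
    case 1
    show thesis
    proof (rule that[of "b + sum base (emb A)" "b + sum base (emb B)"])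
      show "b + sum base (emb B) - (b + sum base (emb A)) \<in> forbidden"
        using 1 by (intro forb') linarith
    qed (use 1 AB(5) sum_base_block_less[OF emb[OF AB(2)]] in simp_all)
  next
    case 2
    show thesis
    proof (rule that[of "b + sum base (emb B)" "b + sum base (emb A)"])
      show "b + sum base (emb A) - (b + sum base (emb B)) \<in> forbidden"
        using 2 by (intro forb) linarith
    qed (use 2 AB(5) sum_base_block_less[OF emb[OF AB(1)]] in simp_all)
  qed
qed

section \<open>Common zero windows and lower frequencies\<close>

lemma shift_map_funpow: "(shift_map ^^ n) x = (\<lambda>i. x (n + i))"
  by (induction n) (auto simp: shift_map_def)

lemma rho_nonneg: "0 \<le> rho x y"
  by (simp add: rho_def)

lemma rho_agree:
  assumes "\<And>i. i < L \<Longrightarrow> x i = y i"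
  shows "rho x y \<le> (1/2) ^ Suc L"
proof (cases "x = y")
  case False
  then obtain i where "x i \<noteq> y i" by auto
  then have "x (LEAST k. x k \<noteq> y k) \<noteq> y (LEAST k. x k \<noteq> y k)" by (rule LeastI)
  then have "L \<le> (LEAST k. x k \<noteq> y k)" using assms by (meson not_le)
  then have "(1/2::real) ^ Suc (LEAST k. x k \<noteq> y k) \<le> (1/2) ^ Suc L"
    by (intro power_decreasing) auto
  then show ?thesis using False by (simp add: rho_def)
qed (simp add: rho_def)

lemma rho_disagree:
  assumes "x 0 \<noteq> y 0"
  shows "rho x y = 1/2"
proof -
  have "(LEAST k. x k \<noteq> y k) = 0" using assms by (intro Least_eq_0) simp
  moreover have "x \<noteq> y" using assms by auto
  ultimately show ?thesis by (simp add: rho_def)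
qed

lemma half_power_less:
  assumes "(0::real) < s"
  obtains L where "(1/2) ^ Suc L < s"
proof -
  obtain L where "(1/2::real) ^ L < s" using real_arch_pow_inv[OF assms, of "1/2"] by auto
  moreover have "(1/2::real) ^ Suc L \<le> (1/2) ^ L" by (rule power_decreasing) auto
  ultimately show thesis using that[of L] by linarith
qed

lemma spacing_shift_iff:
  "x \<in> spacing_shift P \<longleftrightarrow> (\<forall>i j. x i \<longrightarrow> x j \<longrightarrow> i < j \<longrightarrow> j - i \<in> P)"
proof
  assume x: "x \<in> spacing_shift P"
  show "\<forall>i j. x i \<longrightarrow> x j \<longrightarrow> i < j \<longrightarrow> j - i \<in> P"
  proof (intro allI impI)
    fix i j assume "x i" "x j" "i < j"
    then have "nat \<bar>int i - int j\<bar> \<in> P" using x unfolding spacing_shift_def by blast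
    moreover have "nat \<bar>int i - int j\<bar> = j - i" using \<open>i < j\<close> by auto
    ultimately show "j - i \<in> P" by metis
  qed
next
  assume *: "\<forall>i j. x i \<longrightarrow> x j \<longrightarrow> i < j \<longrightarrow> j - i \<in> P"
  have "nat \<bar>int i - int j\<bar> \<in> P" if "x i" "x j" "i \<noteq> j" for i j
  proof (cases "i < j")
    case True
    then have "nat \<bar>int i - int j\<bar> = j - i" by auto
    then show ?thesis using * that True by metis
  next
    case False
    then have "nat \<bar>int i - int j\<bar> = i - j" by auto
    then show ?thesis using * that False by (metis linorder_neqE_nat)
  qed
  then show "x \<in> spacing_shift P" unfolding spacing_shift_def by blast
qed

definition admissible :: "nat set" where
  "admissible = {1..} - forbidden"

text \<open>The search length \<open>scale (2 * L)\<close> is the same for all starting points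
  \<open>b\<close> and all pairs of points. This uniformity gives both proximality and positive
  lower frequency.\<close>

lemma zero_window:
  assumes x: "x \<in> spacing_shift admissible" and y: "y \<in> spacing_shift admissible"
  obtains n where "b \<le> n" "n < b + scale (2 * L)" "\<And>i. i < L \<Longrightarrow> \<not> x (n + i) \<and> \<not> y (n + i)"
proof (rule ccontr)
  note witness = that
  assume "\<not> thesis"
  then have some: "\<exists>i<L. x (n + i) \<or> y (n + i)" if "b \<le> n" "n < b + scale (2 * L)" for n
    using witness that by blast
  \<comment> \<open>Colours below \<open>L\<close> are offsets of a symbol 1 of \<open>x\<close>,
    colours from \<open>L\<close> on are such offsets for \<open>y\<close>, increased by
    \<open>L\<close>. Outside the search interval any value serves, since the colouring has to be
    total.\<close>
  have "\<exists>c\<le>2 * L. b \<le> n \<and> n < b + scale (2 * L) \<longrightarrow> (c < L \<and> x (n + c)) \<or> (L \<le> c \<and> y (n + (c - L)))" for n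
  proof (cases "b \<le> n \<and> n < b + scale (2 * L)")
    case True
    then obtain i where i: "i < L" "x (n + i) \<or> y (n + i)" using some by blast
    then show ?thesis by (cases "x (n + i)") (auto intro: exI[of _ i] exI[of _ "L + i"])
  qed auto
  then obtain col where col: "\<And>n. col n \<le> 2 * L"
      "\<And>n. b \<le> n \<Longrightarrow> n < b + scale (2 * L) \<Longrightarrow>
        (col n < L \<and> x (n + col n)) \<or> (L \<le> col n \<and> y (n + (col n - L)))"
    by metis
  obtain n m where nm: "b \<le> n" "n < m" "m < b + scale (2 * L)" "m - n \<in> forbidden" "col n = col m"
    using forbidden_monochromatic[OF col(1)] .
  have free: "\<not> (z (n + c) \<and> z (m + c))" if "z \<in> spacing_shift admissible" for z c
  proof
    assume "z (n + c) \<and> z (m + c)"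
    then have "(m + c) - (n + c) \<in> admissible"
      using that nm(2) unfolding spacing_shift_iff by (metis add_less_cancel_right)
    then show False using nm(4) by (simp add: admissible_def)
  qed
  show False
    using col(2)[of n] col(2)[of m] nm free[OF x, of "col n"] free[OF y, of "col n - L"] by auto
qed

lemma agree_window:
  assumes "x \<in> spacing_shift admissible" "y \<in> spacing_shift admissible"
  obtains n where "b \<le> n" "n < b + scale (2 * L)"
    "rho ((shift_map ^^ n) x) ((shift_map ^^ n) y) \<le> (1/2) ^ Suc L"
proof -
  obtain n where n: "b \<le> n" "n < b + scale (2 * L)" "\<And>i. i < L \<Longrightarrow> \<not> x (n + i) \<and> \<not> y (n + i)"
    using zero_window[OF assms, where b = b and L = L] by blast
  have "rho ((shift_map ^^ n) x) ((shift_map ^^ n) y) \<le> (1/2) ^ Suc L"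
    using n(3) by (intro rho_agree) (simp add: shift_map_funpow)
  with n(1,2) show thesis by (rule that)
qed

lemma proximal_admissible: "proximal rho (spacing_shift admissible) shift_map"
  unfolding proximal_def
proof (intro ballI antisym)
  fix x y assume xy: "x \<in> spacing_shift admissible" "y \<in> spacing_shift admissible"
  let ?f = "\<lambda>k. ereal (rho ((shift_map ^^ k) x) ((shift_map ^^ k) y))"
  show "0 \<le> liminf ?f"
    by (rule Liminf_bounded) (simp add: rho_nonneg zero_ereal_def)
  show "liminf ?f \<le> 0"
  proof (rule ccontr)
    assume "\<not> liminf ?f \<le> 0"
    then have "(0::ereal) < liminf ?f" by (simp add: not_le)
    then obtain c where c: "0 < ereal c" "ereal c < liminf ?f" using ereal_dense2 by blast
    then have "eventually (\<lambda>k. ereal c < ?f k) sequentially" by (intro less_LiminfD)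
    then obtain b where b: "\<And>k. b \<le> k \<Longrightarrow> ereal c < ?f k" by (auto simp: eventually_sequentially)
    obtain L where L: "(1/2) ^ Suc L < c" using half_power_less c(1) by (metis ereal_less(2))
    obtain n where "b \<le> n" "rho ((shift_map ^^ n) x) ((shift_map ^^ n) y) \<le> (1/2) ^ Suc L"
      using agree_window[OF xy] by blast
    then show False using b[of n] L by simp
  qed
qed

text \<open>Each interval of length \<open>scale (2 * L)\<close> contains a time of closeness, which
  bounds the frequency from below and rules out DC1 pairs.\<close>

lemma lower_distr_pos:
  assumes xy: "x \<in> spacing_shift admissible" "y \<in> spacing_shift admissible" and "0 < s"
  shows "0 < lower_distr rho shift_map x y s"
proof -
  obtain L where L: "(1/2) ^ Suc L < s" using half_power_less \<open>0 < s\<close> by blast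
  let ?R = "scale (2 * L)"
  have "\<exists>n. t * ?R \<le> n \<and> n < t * ?R + ?R \<and> rho ((shift_map ^^ n) x) ((shift_map ^^ n) y) < s" for t
  proof -
    obtain n where "t * ?R \<le> n" "n < t * ?R + ?R"
        "rho ((shift_map ^^ n) x) ((shift_map ^^ n) y) \<le> (1/2) ^ Suc L"
      using agree_window[OF xy, where b = "t * ?R" and L = L] by blast
    with L show ?thesis by (intro exI[of _ n]) linarith
  qed
  then obtain g where g: "\<And>t. t * ?R \<le> g t" "\<And>t. g t < t * ?R + ?R"
      "\<And>t. rho ((shift_map ^^ g t) x) ((shift_map ^^ g t) y) < s" by metis
  have gdiv: "g t div ?R = t" for t
    using g(1,2)[of t] by (intro div_nat_eqI) (auto simp: mult.commute)
  have freq: "1 / (2 * real ?R) \<le> close_freq rho shift_map x y s m" if "?R \<le> m" for m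
  proof -
    let ?A = "{j. j < m \<and> rho ((shift_map ^^ j) x) ((shift_map ^^ j) y) < s}"
    have "inj_on g {..<m div ?R}" by (rule inj_onI) (metis gdiv)
    moreover have "g t < m" if "t < m div ?R" for t
    proof -
      have "g t < Suc t * ?R" using g(2)[of t] by simp
      also have "\<dots> \<le> m div ?R * ?R" using that by (intro mult_le_mono1) simp
      also have "\<dots> \<le> m" by simp
      finally show ?thesis .
    qed
    then have "g ` {..<m div ?R} \<subseteq> ?A" using g(3) by auto
    ultimately have "card {..<m div ?R} \<le> card ?A" by (rule card_inj_on_le) simp
    then have q: "m div ?R \<le> card ?A" by simp
    \<comment> \<open>The factor 2 in the bound absorbs the incomplete last interval.\<close>
    have "m < ?R * (m div ?R) + ?R"
      using mod_less_divisor[OF scale_pos, of m "2 * L"] mult_div_mod_eq[of ?R m] by linarith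
    also have "\<dots> \<le> 2 * ?R * (m div ?R)"
      using div_le_mono[OF that, of ?R] by simp
    also have "\<dots> \<le> 2 * ?R * card ?A" using q by simp
    finally have "real m \<le> real (2 * ?R * card ?A)" by (intro of_nat_mono) simp
    moreover have "0 < m" using that scale_pos[of "2 * L"] by linarith
    ultimately show ?thesis by (simp add: close_freq_def divide_simps ac_simps)
  qed
  have "ereal (1 / (2 * real ?R)) \<le> lower_distr rho shift_map x y s"
    unfolding lower_distr_def
    by (rule Liminf_bounded) (use freq in \<open>auto simp: eventually_sequentially intro!: exI[of _ ?R]\<close>)
  moreover have "(0::ereal) < ereal (1 / (2 * real ?R))" by simp
  ultimately show ?thesis by (rule less_le_trans[rotated])
qed

lemma not_DC1_chaotic_admissible: "\<not> DC1_chaotic rho (spacing_shift admissible) shift_map"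
proof
  assume "DC1_chaotic rho (spacing_shift admissible) shift_map"
  then obtain S where S: "S \<subseteq> spacing_shift admissible" "uncountable S"
      "\<And>x y. x \<in> S \<Longrightarrow> y \<in> S \<Longrightarrow> x \<noteq> y \<Longrightarrow> DC1_scrambled rho shift_map x y"
    unfolding DC1_chaotic_def by blast
  have "infinite S" using S(2) countable_finite by blast
  then obtain x where x: "x \<in> S" by (metis finite.emptyI ex_in_conv)
  have "infinite (S - {x})" using \<open>infinite S\<close> by simp
  then obtain y where y: "y \<in> S" "x \<noteq> y" by (metis DiffE finite.emptyI ex_in_conv singletonI)
  obtain s where "s > 0" "lower_distr rho shift_map x y s = 0"
    using S(3)[OF x y] unfolding DC1_scrambled_def by blast
  then show False using lower_distr_pos[of x y s] S(1) x y by auto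
qed

section \<open>Weak mixing and entropy\<close>

text \<open>A basic open set of the product restricts only finitely many coordinates.\<close>

lemma openin_cylinder:
  fixes X :: "(nat \<Rightarrow> bool) set"
  assumes "openin (top_of_set X) U" "x \<in> U"
  obtains m where "\<forall>y\<in>X. (\<forall>i<m. y i = x i) \<longrightarrow> y \<in> U"
proof -
  obtain T where T: "open T" "U = X \<inter> T" using assms(1) by (auto simp: openin_open)
  then have "openin (product_topology (\<lambda>i. euclidean) UNIV) T" "x \<in> T"
    using assms(2) by (auto simp: open_fun_def)
  from product_topology_open_contains_basis[OF this]
  obtain B where B: "x \<in> Pi\<^sub>E UNIV B" "finite {i. B i \<noteq> UNIV}" "Pi\<^sub>E UNIV B \<subseteq> T" by auto
  obtain m where m: "\<forall>i\<in>{i. B i \<noteq> UNIV}. i < m" using B(2) finite_nat_set_iff_bounded by blast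
  have "y \<in> U" if "y \<in> X" "\<forall>i<m. y i = x i" for y
  proof -
    have "y i \<in> B i" for i
    proof (cases "i < m")
      case True
      then show ?thesis using that(2) B(1) by (auto simp: PiE_iff)
    next
      case False
      then have "B i = UNIV" using m by blast
      then show ?thesis by simp
    qed
    then show ?thesis using B(3) T(2) that(1) by (auto simp: PiE_iff)
  qed
  then show thesis using that by blast
qed

text \<open>If \<open>P\<close> contains all numbers from \<open>k - m\<close> to
  \<open>k + m\<close>, an initial word of \<open>x\<close> at position 0 and one of
  \<open>y\<close> at position \<open>k\<close> fit into one point, because every mixed difference
  lies in that range.\<close>

lemma weakly_mixing_spacing_shift:
  assumes "thick P"
  shows "weakly_mixing (spacing_shift P) shift_map"
  unfolding weakly_mixing_def
proof (intro allI impI, elim conjE)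
  fix U V assume U: "openin (top_of_set (spacing_shift P)) U" "U \<noteq> {}"
    and V: "openin (top_of_set (spacing_shift P)) V" "V \<noteq> {}"
  obtain x y where xy: "x \<in> U" "y \<in> V" using U V by blast
  then have mem: "x \<in> spacing_shift P" "y \<in> spacing_shift P"
    using U V openin_imp_subset by blast+
  obtain m1 where m1: "\<forall>z\<in>spacing_shift P. (\<forall>i<m1. z i = x i) \<longrightarrow> z \<in> U"
    using openin_cylinder[OF U(1) xy(1)] .
  obtain m2 where m2: "\<forall>z\<in>spacing_shift P. (\<forall>i<m2. z i = y i) \<longrightarrow> z \<in> V"
    using openin_cylinder[OF V(1) xy(2)] .
  define m where "m = Suc (max m1 m2)"
  have hit: "k \<in> hitting_times shift_map U V" if "m \<le> k" and P: "\<And>i. k - m \<le> i \<Longrightarrow> i \<le> k + m \<Longrightarrow> i \<in> P" for k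
  proof -
    define z where "z i = ((i < m \<and> x i) \<or> (k \<le> i \<and> i < k + m \<and> y (i - k)))" for i
    have "z \<in> spacing_shift P"
      unfolding spacing_shift_iff
    proof (intro allI impI)
      fix i j assume ij: "z i" "z j" "i < j"
      consider "j < m" | "i < m" "k \<le> j" | "k \<le> i" using ij by (auto simp: z_def)
      then show "j - i \<in> P"
      proof cases
        case 1
        then have "x i" "x j" using ij \<open>m \<le> k\<close> by (auto simp: z_def)
        then show ?thesis using mem(1) ij(3) spacing_shift_iff by blast
      next
        case 2
        then have "j < k + m" using ij \<open>m \<le> k\<close> by (auto simp: z_def)
        then show ?thesis using 2 by (intro P) auto
      next
        case 3
        then have "y (i - k)" "y (j - k)" "i - k < j - k" using ij \<open>m \<le> k\<close> by (auto simp: z_def)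
        then have "(j - k) - (i - k) \<in> P" using mem(2) spacing_shift_iff by blast
        then show ?thesis using 3 by simp
      qed
    qed
    then have "z \<in> U" using \<open>m \<le> k\<close> by (intro m1[rule_format]) (auto simp: z_def m_def)
    \<comment> \<open>The image is only a truncation of \<open>y\<close>, which still agrees with
      \<open>y\<close> on the coordinates that decide membership in \<open>V\<close>.\<close>
    have shift: "(shift_map ^^ k) z = (\<lambda>i. i < m \<and> y i)"
      unfolding shift_map_funpow z_def using \<open>m \<le> k\<close> by auto
    have "(\<lambda>i. i < m \<and> y i) \<in> spacing_shift P" using mem(2) by (simp add: spacing_shift_iff)
    then have "(shift_map ^^ k) z \<in> V" unfolding shift by (rule m2[rule_format]) (auto simp: m_def)
    moreover have "0 < k" using \<open>m \<le> k\<close> by (simp add: m_def)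
    ultimately show ?thesis using \<open>z \<in> U\<close> unfolding hitting_times_def by blast
  qed
  show "thick (hitting_times shift_map U V)"
    unfolding thick_def
  proof
    fix n
    obtain a where a: "{a..<a + (n + 3 * m)} \<subseteq> P" using assms unfolding thick_def by blast
    have "{a + m..<a + m + n} \<subseteq> hitting_times shift_map U V"
    proof
      fix k assume "k \<in> {a + m..<a + m + n}"
      then show "k \<in> hitting_times shift_map U V" using a by (intro hit) (auto simp: m_def)
    qed
    then show "\<exists>a. {a..<a + n} \<subseteq> hitting_times shift_map U V" by blast
  qed
qed

lemma admissible_gap: "scale k \<le> m \<Longrightarrow> m \<le> 3 * scale k \<Longrightarrow> m \<in> admissible"
  using forbidden_gap[of k m] less_le_trans[OF scale_pos[of k]] by (auto simp: admissible_def Suc_le_eq)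

lemma thick_admissible: "thick admissible"
  unfolding thick_def
proof
  fix n
  have "{scale n..<scale n + n} \<subseteq> admissible"
    using scale_ge[of n] by (auto intro: admissible_gap)
  then show "\<exists>a. {a..<a + n} \<subseteq> admissible" by blast
qed

lemma separated_admissible:
  "n \<in> separated k \<Longrightarrow> m \<in> separated k \<Longrightarrow> n < m \<Longrightarrow> m - n \<in> admissible"
  using separated(3) by (auto simp: admissible_def)

lemma separated_less: "n \<in> separated k \<Longrightarrow> n < scale k"
  using separated(1) by (auto simp: good_def)

lemma finite_separated [simp]: "finite (separated k)"
  by (rule finite_subset[of _ "{..<scale k}"]) (auto simp: separated_less)

section \<open>Entropy as a limit and its lower bound\<close>

text \<open>Fekete's lemma: the limit is the infimum. Division of \<open>n\<close> by a nearly
  optimal \<open>p\<close> leaves a remainder term bounded by the constant \<open>C\<close>.\<close>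

lemma subadditive_imp_convergent:
  fixes a :: "nat \<Rightarrow> real"
  assumes sub: "\<And>m n. a (m + n) \<le> a m + a n" and nonneg: "\<And>n. 0 \<le> a n"
  shows "convergent (\<lambda>n. a n / real n)"
proof -
  define L where "L = (INF n\<in>{1..}. a n / real n)"
  have bdd: "bdd_below ((\<lambda>n. a n / real n) ` {1..})"
    by (rule bdd_belowI[of _ 0]) (auto simp: nonneg)
  have mult: "a (q * p) \<le> real q * a p" if "q \<ge> 1" for q p
    using that
  proof (induction q rule: dec_induct)
    case (step q)
    then show ?case using sub[of p "q * p"] by (simp add: algebra_simps)
  qed simp
  have "(\<lambda>n. a n / real n) \<longlonglongrightarrow> L"
  proof (rule LIMSEQ_I)
    fix e :: real assume "0 < e"
    have "L < L + e / 2" using \<open>0 < e\<close> by simp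
    then obtain p where p: "1 \<le> p" "a p / real p < L + e / 2"
      unfolding L_def using cINF_less_iff[OF _ bdd] by (metis atLeast_iff empty_iff order_refl)
    define C where "C = (\<Sum>r<p. a r)"
    have C: "a r \<le> C" if "r < p" for r
      unfolding C_def using that nonneg by (intro member_le_sum) auto
    obtain N where N: "2 * C / e < real N" using reals_Archimedean2 by blast
    show "\<exists>no. \<forall>n\<ge>no. norm (a n / real n - L) < e"
    proof (intro exI allI impI)
      fix n assume n: "max (Suc N) p \<le> n"
      then have n0: "0 < real n" by simp
      have q1: "1 \<le> n div p" using n p(1) div_le_mono[of p n p] by simp
      have "a n = a (n div p * p + n mod p)" by simp
      also have "\<dots> \<le> a (n div p * p) + a (n mod p)" by (rule sub)
      also have "\<dots> \<le> real (n div p) * a p + C"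
        using mult[OF q1] C[of "n mod p"] p(1) by (intro add_mono) auto
      also have "real (n div p) * a p \<le> real n / real p * a p"
        using nonneg by (intro mult_right_mono of_nat_div_le_of_nat)
      finally have "a n / real n \<le> (real n / real p * a p + C) / real n"
        using n0 by (intro divide_right_mono) auto
      also have "\<dots> = a p / real p + C / real n" using n0 by (simp add: add_divide_distrib)
      also have "C / real n < e / 2"
      proof -
        have "2 * C / e < real n" using N n by simp
        then show ?thesis using n0 \<open>0 < e\<close> by (simp add: field_simps)
      qed
      finally have "a n / real n < L + e" using p(2) by simp
      moreover have "L \<le> a n / real n"
        unfolding L_def using n by (intro cINF_lower[OF bdd]) auto
      ultimately show "norm (a n / real n - L) < e" by simp
    qed
  qed
  then show ?thesis by (rule convergentI)
qed

lemma finite_words: "finite (words k X)"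
proof (rule finite_subset)
  show "words k X \<subseteq> {w. set w \<subseteq> UNIV \<and> length w = k}" by (auto simp: words_def)
  show "finite {w :: bool list. set w \<subseteq> UNIV \<and> length w = k}" by (rule finite_lists_length_eq) simp
qed

lemma card_words_pos: "X \<noteq> {} \<Longrightarrow> 0 < card (words k X)"
proof -
  assume "X \<noteq> {}"
  then have "words k X \<noteq> {}" by (auto simp: words_def)
  then show ?thesis by (simp add: card_gt_0_iff finite_words)
qed

lemma card_words_add: "card (words (m + n) X) \<le> card (words m X) * card (words n X)"
proof -
  have "inj_on (\<lambda>w. (take m w, drop m w)) (words (m + n) X)"
    by (rule inj_onI) (metis append_take_drop_id prod.inject)
  moreover have "(\<lambda>w. (take m w, drop m w)) ` words (m + n) X \<subseteq> words m X \<times> words n X"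
  proof (rule image_subsetI)
    fix w assume "w \<in> words (m + n) X"
    then obtain x i where w: "w = map x [i..<i + (m + n)]" "x \<in> X" by (auto simp: words_def)
    have "take m w = map x [i..<i + m]" "drop m w = map x [i + m..<i + m + n]"
      unfolding w(1) by (auto simp: take_map drop_map add.assoc)
    then show "(take m w, drop m w) \<in> words m X \<times> words n X" using w(2) unfolding words_def by blast
  qed
  moreover have "finite (words m X \<times> words n X)" by (simp add: finite_words)
  ultimately have "card (words (m + n) X) \<le> card (words m X \<times> words n X)" by (rule card_inj_on_le)
  then show ?thesis by (simp add: card_cartesian_product)
qed

text \<open>Since \<open>entropy\<close> is a \<open>lim\<close>, convergence has to be known before
  its value can be read off along the lengths \<open>scale k\<close>.\<close>

lemma entropy_LIMSEQ:
  assumes "X \<noteq> {}"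
  shows "(\<lambda>k. log 2 (real (card (words k X))) / real k) \<longlonglongrightarrow> entropy X"
proof -
  let ?a = "\<lambda>k. log 2 (real (card (words k X)))"
  have pos: "0 < card (words k X)" for k using card_words_pos[OF assms] .
  have "?a (m + n) \<le> ?a m + ?a n" for m n
  proof -
    have "?a (m + n) \<le> log 2 (real (card (words m X) * card (words n X)))"
      using pos[of "m + n"] card_words_add[of m n X] by (intro log_mono) (auto simp del: of_nat_mult)
    also have "\<dots> = ?a m + ?a n" using pos[of m] pos[of n] by (simp add: log_mult)
    finally show ?thesis .
  qed
  moreover have "0 \<le> ?a k" for k using pos[of k] by simp
  ultimately have "convergent (\<lambda>k. ?a k / real k)" by (rule subadditive_imp_convergent)
  then show ?thesis unfolding entropy_def by (rule convergent_LIMSEQ_iff[THEN iffD1])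
qed

lemma strict_mono_scale: "strict_mono scale"
proof (rule strict_mono_Suc_iff[THEN iffD2], rule allI)
  fix k
  have "2 ^ (k + 6) * scale k \<le> scale (Suc k)" by (rule scale_growth) simp
  moreover have "2 * scale k \<le> 2 ^ (k + 6) * scale k"
    using power_increasing[of 1 "k + 6" "2::nat"] by (intro mult_le_mono1) simp
  ultimately show "scale k < scale (Suc k)" using scale_pos[of k] by linarith
qed

text \<open>Every subset of \<open>separated k\<close> gives a word of length
  \<open>scale k\<close>, and \<open>separated k\<close> fills at least a quarter of that
  length.\<close>

lemma entropy_admissible: "1 / 4 \<le> entropy (spacing_shift admissible)"
proof -
  let ?X = "spacing_shift admissible"
  have "(\<lambda>_. False) \<in> ?X" by (simp add: spacing_shift_iff)
  then have lim: "(\<lambda>k. log 2 (real (card (words k ?X))) / real k) \<longlonglongrightarrow> entropy ?X"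
    by (intro entropy_LIMSEQ) auto
  have "(\<lambda>k. log 2 (real (card (words (scale k) ?X))) / real (scale k)) \<longlonglongrightarrow> entropy ?X"
    using LIMSEQ_subseq_LIMSEQ[OF lim strict_mono_scale] by (simp add: o_def)
  moreover have "1 / 4 \<le> log 2 (real (card (words (scale k) ?X))) / real (scale k)" for k
  proof -
    let ?w = "\<lambda>S. map (\<lambda>n. n \<in> S) [0..<scale k]"
    have "inj_on ?w (Pow (separated k))"
    proof (rule inj_onI)
      fix S T assume ST: "S \<in> Pow (separated k)" "T \<in> Pow (separated k)" "?w S = ?w T"
      have "n \<in> S \<longleftrightarrow> n \<in> T" if "n < scale k" for n
        using arg_cong[OF ST(3), of "\<lambda>w. w ! n"] that by simp
      then show "S = T" using ST(1,2) separated_less by blast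
    qed
    moreover have "?w ` Pow (separated k) \<subseteq> words (scale k) ?X"
    proof (rule image_subsetI)
      fix S assume "S \<in> Pow (separated k)"
      then have "(\<lambda>n. n \<in> S) \<in> ?X" using separated_admissible unfolding spacing_shift_iff by blast
      then show "?w S \<in> words (scale k) ?X" unfolding words_def by (intro CollectI exI[of _ "\<lambda>n. n \<in> S"] exI[of _ 0]) simp
    qed
    ultimately have "card (Pow (separated k)) \<le> card (words (scale k) ?X)"
      using finite_words by (rule card_inj_on_le)
    then have "real (card (Pow (separated k))) \<le> real (card (words (scale k) ?X))"
      by (rule of_nat_mono)
    then have "2 ^ card (separated k) \<le> real (card (words (scale k) ?X))"
      by (simp add: card_Pow)
    then have "real (card (separated k)) \<le> log 2 (real (card (words (scale k) ?X)))"
      by (intro le_log_of_power) auto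
    moreover have "real (scale k) \<le> 4 * real (card (separated k))"
      using card_separated[of k] by linarith
    ultimately show ?thesis using scale_pos[of k] by (simp add: field_simps)
  qed
  ultimately show ?thesis by (intro LIMSEQ_le_const) auto
qed

section \<open>Distributional chaos of type 2\<close>

text \<open>The translation by \<open>2 * scale k\<close> puts all differences to earlier layers
  between \<open>scale k\<close> and \<open>3 * scale k\<close>, where nothing is forbidden.\<close>

definition layer :: "nat \<Rightarrow> nat set" where
  "layer k = (+) (2 * scale k) ` separated k"

text \<open>Every label \<open>b\<close> is \<open>fst (prod_decode k)\<close> for infinitely many \<open>k\<close>, so points with
  different label sets differ on infinitely many layers.\<close>

definition layer_point :: "nat set \<Rightarrow> nat \<Rightarrow> bool" where
  "layer_point B n \<longleftrightarrow> (\<exists>k. fst (prod_decode k) \<in> B \<and> n \<in> layer k)"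

lemma layer_bounds: "n \<in> layer k \<Longrightarrow> 2 * scale k \<le> n \<and> n < 3 * scale k"
  using separated_less by (auto simp: layer_def)

lemma scale_less: "k < l \<Longrightarrow> 64 * scale k \<le> scale l"
proof -
  assume "k < l"
  then have "2 ^ (k + 6) * scale k \<le> scale l" by (rule scale_growth)
  moreover have "2 ^ 6 * scale k \<le> 2 ^ (k + 6) * scale k"
    by (intro mult_le_mono1 power_increasing) auto
  ultimately have "2 ^ 6 * scale k \<le> scale l" by (rule order.trans[rotated])
  then show ?thesis by simp
qed

lemma layer_unique:
  assumes "n \<in> layer k" "n \<in> layer l"
  shows "k = l"
  using layer_bounds[OF assms(1)] layer_bounds[OF assms(2)] scale_less[of k l] scale_less[of l k]
  by (cases k l rule: linorder_cases) auto

lemma layer_point_in_layer: "n \<in> layer k \<Longrightarrow> layer_point B n \<longleftrightarrow> fst (prod_decode k) \<in> B"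
  using layer_unique by (auto simp: layer_point_def)

lemma layer_point_gap:
  assumes "3 * scale k \<le> n" "n < 2 * scale (Suc k)"
  shows "\<not> layer_point B n"
proof
  assume "layer_point B n"
  then obtain l where l: "2 * scale l \<le> n" "n < 3 * scale l"
    using layer_bounds by (auto simp: layer_point_def)
  show False
  proof (cases "l \<le> k")
    case True
    then show False using scale_mono[OF True] l(2) assms(1) by simp
  next
    case False
    then show False using scale_mono[of "Suc k" l] l(1) assms(2) by simp
  qed
qed

text \<open>Differences within a layer are those of \<open>separated\<close>; differences between
  layers fall into a gap of \<open>forbidden\<close>.\<close>

lemma layer_point_spacing_shift: "layer_point B \<in> spacing_shift admissible"
  unfolding spacing_shift_iff
proof (intro allI impI)
  fix n m assume "layer_point B n" "layer_point B m" "n < m"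
  then obtain k l where k: "n \<in> layer k" and l: "m \<in> layer l" by (auto simp: layer_point_def)
  note bounds = layer_bounds[OF k] layer_bounds[OF l]
  consider "k = l" | "k < l" | "l < k" by linarith
  then show "m - n \<in> admissible"
  proof cases
    case 1
    then obtain n' m' where "n' \<in> separated k" "m' \<in> separated k"
        "n = 2 * scale k + n'" "m = 2 * scale k + m'"
      using k l by (auto simp: layer_def)
    then show ?thesis using separated_admissible[of n' k m'] \<open>n < m\<close> by simp
  next
    case 2
    then show ?thesis using bounds scale_less[of k l] by (intro admissible_gap[of l]) auto
  next
    case 3
    then show ?thesis using bounds scale_less[of l k] \<open>n < m\<close> by simp
  qed
qed

lemma card_layer: "scale k \<le> 4 * card (layer k)"
proof -
  have "card (layer k) = card (separated k)" unfolding layer_def by (rule card_image) simp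
  then show ?thesis using card_separated by simp
qed

lemma close_freq_le_1: "close_freq d f x y t m \<le> 1"
proof -
  have "card {j. j < m \<and> d ((f ^^ j) x) ((f ^^ j) y) < t} \<le> card {..<m}"
    by (rule card_mono) auto
  then show ?thesis by (cases "m = 0") (simp_all add: close_freq_def)
qed

text \<open>Both points vanish from \<open>3 * scale k\<close> up to the next layer, which starts at
  least \<open>2 ^ (k + 6)\<close> times further out; near the end of the gap \<open>L\<close> times
  are lost to the window.\<close>

lemma close_freq_layer_gap:
  assumes "(1/2) ^ Suc L < t"
  shows "1 - real (L + 3) / 2 ^ (k + 6)
    \<le> close_freq rho shift_map (layer_point B) (layer_point C) t (2 * scale (Suc k))"
proof -
  let ?m = "2 * scale (Suc k)" and ?x = "layer_point B" and ?y = "layer_point C"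
  let ?A = "{j. j < ?m \<and> rho ((shift_map ^^ j) ?x) ((shift_map ^^ j) ?y) < t}"
  have "{3 * scale k..<?m - L} \<subseteq> ?A"
  proof
    fix j assume j: "j \<in> {3 * scale k..<?m - L}"
    have "rho ((shift_map ^^ j) ?x) ((shift_map ^^ j) ?y) \<le> (1/2) ^ Suc L"
    proof (rule rho_agree)
      fix i assume "i < L"
      then have "3 * scale k \<le> j + i" "j + i < 2 * scale (Suc k)" using j by auto
      then show "(shift_map ^^ j) ?x i = (shift_map ^^ j) ?y i"
        using layer_point_gap by (simp add: shift_map_funpow)
    qed
    then show "j \<in> ?A" using assms j by auto
  qed
  then have "card {3 * scale k..<?m - L} \<le> card ?A" by (rule card_mono[rotated]) simp
  then have "?m \<le> card ?A + L + 3 * scale k" by simp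
  also have "L * 1 \<le> L * scale k" using scale_pos[of k] by (intro mult_le_mono2) (simp add: Suc_le_eq)
  then have "L + 3 * scale k \<le> (L + 3) * scale k" by (simp add: add_mult_distrib)
  then have "card ?A + L + 3 * scale k \<le> card ?A + (L + 3) * scale k" by simp
  finally have "real ?m \<le> real (card ?A + (L + 3) * scale k)" by (rule of_nat_mono)
  then have 1: "real ?m \<le> real (card ?A) + real (L + 3) * real (scale k)"
    by (simp only: of_nat_add of_nat_mult)
  have "2 ^ (k + 6) * scale k \<le> ?m" using scale_growth[of k "Suc k"] by simp
  then have "real (2 ^ (k + 6) * scale k) \<le> real ?m" by (rule of_nat_mono)
  then have 2: "real (scale k) \<le> real ?m / 2 ^ (k + 6)" by (simp add: field_simps)
  have "real (L + 3) * real (scale k) \<le> real (L + 3) * (real ?m / 2 ^ (k + 6))"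
    using 2 by (intro mult_left_mono) auto
  with 1 have "(1 - real (L + 3) / 2 ^ (k + 6)) * real ?m \<le> real (card ?A)"
    by (simp add: algebra_simps)
  moreover have "0 < real ?m" using scale_pos[of "Suc k"] by simp
  ultimately show ?thesis unfolding close_freq_def by (simp only: pos_le_divide_eq)
qed

text \<open>On layer \<open>k\<close> the points differ in their first symbol, so the distance is
  exactly 1/2 and not below it. The layer has at least \<open>scale k / 4\<close> of the
  \<open>3 * scale k\<close> times, a twelfth.\<close>

lemma close_freq_layer:
  assumes "fst (prod_decode k) \<in> B \<longleftrightarrow> fst (prod_decode k) \<notin> C"
  shows "close_freq rho shift_map (layer_point B) (layer_point C) (1/2) (3 * scale k) \<le> 11 / 12"
proof -
  let ?x = "layer_point B" and ?y = "layer_point C"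
  let ?A = "{j. j < 3 * scale k \<and> rho ((shift_map ^^ j) ?x) ((shift_map ^^ j) ?y) < 1/2}"
  have "rho ((shift_map ^^ j) ?x) ((shift_map ^^ j) ?y) = 1/2" if "j \<in> layer k" for j
    using that assms by (intro rho_disagree) (simp add: shift_map_funpow layer_point_in_layer)
  then have "?A \<subseteq> {..<3 * scale k} - layer k" by force
  then have "card ?A \<le> card ({..<3 * scale k} - layer k)" by (rule card_mono[rotated]) simp
  also have "\<dots> = 3 * scale k - card (layer k)"
    using layer_bounds by (subst card_Diff_subset) (auto simp: layer_def)
  finally have "12 * card ?A \<le> 33 * scale k"
    using card_layer[of k] by linarith
  then have "real (12 * card ?A) \<le> real (33 * scale k)" by (rule of_nat_mono)
  then show ?thesis using scale_pos[of k] by (simp add: close_freq_def divide_simps)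
qed

text \<open>Upper frequency 1 is seen at the ends of the long common gaps, lower frequency at most
  11/12 at the ends of the layers whose label separates \<open>B\<close> from
  \<open>C\<close>.\<close>

lemma DC2_scrambled_layer_point:
  assumes "B \<noteq> C"
  shows "DC2_scrambled rho shift_map (layer_point B) (layer_point C)"
  unfolding DC2_scrambled_def
proof (intro conjI allI impI exI[of _ "1/2 :: real"])
  let ?F = "close_freq rho shift_map (layer_point B) (layer_point C)"
  fix t :: real assume "0 < t"
  show "upper_distr rho shift_map (layer_point B) (layer_point C) t = 1"
    unfolding upper_distr_def
  proof (rule antisym)
    show "limsup (\<lambda>m. ereal (?F t m)) \<le> 1"
      by (rule Limsup_bounded) (simp add: close_freq_le_1)
    show "1 \<le> limsup (\<lambda>m. ereal (?F t m))"
    proof (rule ccontr)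
      assume "\<not> 1 \<le> limsup (\<lambda>m. ereal (?F t m))"
      then have "limsup (\<lambda>m. ereal (?F t m)) < 1" by simp
      then obtain c where c: "limsup (\<lambda>m. ereal (?F t m)) < ereal c" "ereal c < 1"
        using ereal_dense2 by blast
      then have "eventually (\<lambda>m. ereal (?F t m) < ereal c) sequentially" by (intro Limsup_lessD)
      then obtain m0 where m0: "\<And>m. m0 \<le> m \<Longrightarrow> ?F t m < c" by (auto simp: eventually_sequentially)
      obtain L where L: "(1/2) ^ Suc L < t" using half_power_less \<open>0 < t\<close> by blast
      have "0 < (1 - c) / real (L + 3)" using c(2) by simp
      then obtain k0 where "(1/2) ^ k0 < (1 - c) / real (L + 3)"
        using real_arch_pow_inv[of _ "1/2 :: real"] by auto
      moreover define k where "k = max k0 m0"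
      have "(1/2 :: real) ^ (k + 6) \<le> (1/2) ^ k0" by (rule power_decreasing) (auto simp: k_def)
      ultimately have "(1/2) ^ (k + 6) < (1 - c) / real (L + 3)" by linarith
      then have "real (L + 3) / 2 ^ (k + 6) < 1 - c"
        by (simp add: power_one_over field_simps)
      then have "c < ?F t (2 * scale (Suc k))" using close_freq_layer_gap[OF L, of k B C] by linarith
      moreover have "m0 \<le> 2 * scale (Suc k)" using scale_ge[of "Suc k"] by (simp add: k_def)
      then have "?F t (2 * scale (Suc k)) < c" by (rule m0)
      ultimately show False by simp
    qed
  qed
next
  let ?F = "close_freq rho shift_map (layer_point B) (layer_point C)"
  obtain b where b: "b \<in> B \<longleftrightarrow> b \<notin> C" using assms by blast
  have "liminf (\<lambda>m. ereal (?F (1/2) m)) \<le> ereal (11/12)"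
  proof (rule ccontr)
    assume "\<not> liminf (\<lambda>m. ereal (?F (1/2) m)) \<le> ereal (11/12)"
    then have "ereal (11/12) < liminf (\<lambda>m. ereal (?F (1/2) m))" by simp
    then have "eventually (\<lambda>m. ereal (11/12) < ereal (?F (1/2) m)) sequentially" by (rule less_LiminfD)
    then obtain m0 where m0: "\<And>m. m0 \<le> m \<Longrightarrow> 11/12 < ?F (1/2) m" by (auto simp: eventually_sequentially)
    \<comment> \<open>A layer carrying the separating label \<open>b\<close> whose index is at least
      \<open>m0\<close>.\<close>
    define k where "k = prod_encode (b, m0)"
    have "m0 \<le> k" unfolding k_def by (rule le_prod_encode_2)
    then have "m0 \<le> 3 * scale k" using scale_ge[of k] by simp
    then have "11/12 < ?F (1/2) (3 * scale k)" by (rule m0)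
    moreover have "?F (1/2) (3 * scale k) \<le> 11/12"
      using b by (intro close_freq_layer) (simp add: k_def)
    ultimately show False by simp
  qed
  also have "ereal (11/12) < 1" by simp
  finally show "lower_distr rho shift_map (layer_point B) (layer_point C) (1/2) < 1"
    unfolding lower_distr_def .
qed simp

lemma inj_layer_point: "inj layer_point"
proof (rule injI, rule ccontr)
  fix B C assume eq: "layer_point B = layer_point C" and "B \<noteq> C"
  then obtain b where b: "b \<in> B \<longleftrightarrow> b \<notin> C" by blast
  let ?k = "prod_encode (b, 0)"
  have "0 < card (layer ?k)" using card_layer[of ?k] scale_pos[of ?k] by linarith
  then obtain n where "n \<in> layer ?k" by (metis card.empty ex_in_conv less_irrefl)
  then have "layer_point B n \<noteq> layer_point C n" using b by (simp add: layer_point_in_layer)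
  then show False using eq by simp
qed

lemma DC2_chaotic_admissible: "DC2_chaotic rho (spacing_shift admissible) shift_map"
  unfolding DC2_chaotic_def
proof (intro exI[of _ "range layer_point"] conjI ballI impI)
  show "range layer_point \<subseteq> spacing_shift admissible" using layer_point_spacing_shift by blast
  show "uncountable (range layer_point)"
  proof
    assume "countable (range layer_point)"
    then have "countable (UNIV :: nat set set)" using inj_layer_point by (rule countable_image_inj_on)
    then have "\<exists>f :: nat \<Rightarrow> nat set. range f = UNIV"
      using uncountable_def[of "UNIV :: nat set set"] by simp
    then have "\<exists>f :: nat \<Rightarrow> nat set. range f = Pow UNIV" by (simp only: Pow_UNIV)
    then show False using Cantors_theorem[of "UNIV :: nat set"] by (rule notE[rotated])
  qed
  fix x y assume "x \<in> range layer_point" "y \<in> range layer_point" "x \<noteq> y"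
  then obtain B C where "x = layer_point B" "y = layer_point C" "B \<noteq> C" by auto
  then show "DC2_scrambled rho shift_map x y" by (simp add: DC2_scrambled_layer_point)
qed

theorem theorem25:
  shows "(\<exists>P\<subseteq>{1::nat..}. weakly_mixing (spacing_shift P) shift_map
            \<and> proximal rho (spacing_shift P) shift_map
            \<and> entropy (spacing_shift P) > 0)
       \<and> (\<exists>P\<subseteq>{1::nat..}. DC2_chaotic rho (spacing_shift P) shift_map
            \<and> \<not> DC1_chaotic rho (spacing_shift P) shift_map)"
\<comment> \<open>The same set witnesses both existential claims.\<close>
proof (intro conjI exI[of _ admissible])
  show "admissible \<subseteq> {1..}" "admissible \<subseteq> {1..}" by (auto simp: admissible_def)
  show "0 < entropy (spacing_shift admissible)" using entropy_admissible by linarith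
qed (rule weakly_mixing_spacing_shift thick_admissible proximal_admissible
  DC2_chaotic_admissible not_DC1_chaotic_admissible)+

end
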